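(* Let $(\mathcal{E},\mathcal{F})$ and $(\mathcal{E}^n,\mathcal{F}^n)$, $n\ge 1$, be closed symmetric forms on $L^2(E;m)$ (their domains are not assumed to be dense in $L^2(E;m)$). Let $\overline{\mathcal{F}^n}$ and $\overline{\mathcal{F}}$ be the closures of $\mathcal{F}^n$ and $\mathcal{F}$ in $L^2(E;m)$, respectively. Suppose that $\overline{\mathcal{F}^n}\supset\overline{\mathcal{F}}$ for every $n\ge 1$. Let $\{\widehat P^n_t; t\ge 0\}$ and $\{\widehat P_t;t\ge 0\}$ be the semigroups on $\overline{\mathcal{F}^n}$ and $\overline{\mathcal{F}}$ associated with $(\mathcal{E}^n,\mathcal{F}^n)$ and $(\mathcal{E},\mathcal{F})$, respectively. Then the following hold. (i) If $(\mathcal{E}^n,\mathcal{F}^n)$ converges to $(\mathcal{E},\mathcal{F})$ in the sense of Mosco, then for every $t>0$ and $f\in\overline{\mathcal{F}}$, $\widehat P^n_t f$ converges to $\widehat P_t f$ in $L^2(E;m)$ as $n\to\infty$. (ii) Suppose that the closed subspaces $\overline{\mathcal{F}^n}$ converge to $\overline{\mathcal{F}}$ in $L^2(E;m)$ in the sense that $$\lim_{n\to\infty}\|\Pi^n f-\Pi f\|_{L^2(E;m)}=0\quad\text{for every } f\in L^2(E;m),$$ where $\Pi^n$ and $\Pi$ denote the orthogonal projection operators of $L^2(E;m)$ onto $\overline{\mathcal{F}^n}$ and $\overline{\mathcal{F}}$, respectively. If $\widehat P^n_t f$ converges to $\widehat P_t f$ in $L^2(E;m)$ for every $t>0$ and $f\in\overline{\mathcal{F}}$,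 then $(\mathcal{E}^n,\mathcal{F}^n)$ converges to $(\mathcal{E},\mathcal{F})$ in the sense of Mosco.
   Context: $E$ is a locally compact separable metric space and $m$ is a Radon measure on $E$ with full support. A closed symmetric form on $L^2(E;m)$ is a pair $(\mathcal{E},\mathcal{F})$ where $\mathcal{F}$ is a linear subspace of $L^2(E;m)$ (not necessarily dense) and $\mathcal{E}$ is a non-negative definite symmetric bilinear form on $\mathcal{F}\times\mathcal{F}$ such that $\mathcal{F}$ is a Hilbert space with inner product $\mathcal{E}_1$; here, for $\alpha>0$, $\mathcal{E}_\alpha(f,g):=\mathcal{E}(f,g)+\alpha (f,g)_{L^2(E;m)}$. Convention: $\mathcal{E}(f,f):=\infty$ for $f\in L^2(E;m)\setminus\mathcal{F}$. Associated semigroup: $(\mathcal{E},\mathcal{F})$ is a densely defined closed symmetric form on the Hilbert space $\overline{\mathcal{F}}$ (with the $L^2(E;m)$ inner product). For $f\in\overline{\mathcal{F}}$ and $\alpha>0$, $\widehat G_\alpha f\in\mathcal{F}$ is the unique element with $\mathcal{E}_\alpha(\widehat G_\alpha f,g)=(f,g)_{L^2(E;m)}$ for every $g\in\mathcal{F}$; $\{\widehat G_\alpha;\alpha>0\}$ is a strongly continuous contraction symmetric resolvent on $\overline{\mathcal{F}}$, and $\{\widehat P_t;t\ge0\}$ is the unique strongly continuous contraction symmetric semigroup on $\overline{\mathcal{F}}$ with $\widehat G_\alpha f=\int_0^\infty e^{-\alpha t}\widehat P_t f\,dt$ for $f\in\overline{\mathcal{F}}$, $\alpha>0$. The semigroup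 $\{\widehat P^n_t\}$ on $\overline{\mathcal{F}^n}$ is defined likewise from $(\mathcal{E}^n,\mathcal{F}^n)$. Mosco convergence: $(\mathcal{E}^n,\mathcal{F}^n)$ converges to $(\mathcal{E},\mathcal{F})$ in the sense of Mosco if (a) for every sequence $\{u_n\}$ in $L^2(E;m)$ converging weakly to $u$ in $L^2(E;m)$, $\liminf_{n\to\infty}\mathcal{E}^n(u_n,u_n)\ge\mathcal{E}(u,u)$; and (b) for every $u\in L^2(E;m)$ there is a sequence $\{u_n\}$ in $L^2(E;m)$ converging strongly to $u$ in $L^2(E;m)$ such that $\limsup_{n\to\infty}\mathcal{E}^n(u_n,u_n)\le\mathcal{E}(u,u)$. *)

theory Defs
  imports "HOL-Analysis.Analysis"
begin

(* sigma-finiteness is not required: on a locally compact separable metric space it follows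
   from finiteness on compact sets. *)
definition radon_measure :: "'a::metric_space measure \<Rightarrow> bool" where
  "radon_measure m \<longleftrightarrow>
     sets m = sets borel \<and>
     (\<forall>K. compact K \<longrightarrow> emeasure m K < \<infinity>) \<and>
     (\<forall>B\<in>sets borel. emeasure m B = (INF U\<in>{U. open U \<and> B \<subseteq> U}. emeasure m U)) \<and>
     (\<forall>U. open U \<longrightarrow> emeasure m U = (SUP K\<in>{K. compact K \<and> K \<subseteq> U}. emeasure m K))"

definition full_support :: "'a::metric_space measure \<Rightarrow> bool" where
  "full_support m \<longleftrightarrow> (\<forall>U. open U \<and> U \<noteq> {} \<longrightarrow> emeasure m U > 0)"


section \<open>The space \<open>L\<^sup>2(E;m)\<close>\<close>

text \<open>
  Elements of \<open>L\<^sup>2(E;m)\<close> are handled through representatives: equality in \<open>L\<^sup>2(E;m)\<close> is equality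
  almost everywhere, a subset of \<open>L\<^sup>2(E;m)\<close> is a set of representatives that is saturated
  for equality almost everywhere, and \<^term>\<open>l2_norm m\<close> below is a seminorm on representatives.
\<close>

definition l2_space :: "'a measure \<Rightarrow> ('a \<Rightarrow> real) set" where
  "l2_space m = {f \<in> borel_measurable m. integrable m (\<lambda>x. (f x)\<^sup>2)}"

definition l2_inner :: "'a measure \<Rightarrow> ('a \<Rightarrow> real) \<Rightarrow> ('a \<Rightarrow> real) \<Rightarrow> real" where
  "l2_inner m f g = (LINT x|m. f x * g x)"

definition l2_norm :: "'a measure \<Rightarrow> ('a \<Rightarrow> real) \<Rightarrow> real" where
  "l2_norm m f = sqrt (l2_inner m f f)"

definition l2_tendsto :: "'a measure \<Rightarrow> (nat \<Rightarrow> 'a \<Rightarrow> real) \<Rightarrow> ('a \<Rightarrow> real) \<Rightarrow> bool" where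
  "l2_tendsto m u v \<longleftrightarrow> (\<lambda>n. l2_norm m (\<lambda>x. u n x - v x)) \<longlonglongrightarrow> 0"

definition l2_weak_tendsto :: "'a measure \<Rightarrow> (nat \<Rightarrow> 'a \<Rightarrow> real) \<Rightarrow> ('a \<Rightarrow> real) \<Rightarrow> bool" where
  "l2_weak_tendsto m u v \<longleftrightarrow>
     (\<forall>g\<in>l2_space m. (\<lambda>n. l2_inner m (u n) g) \<longlonglongrightarrow> l2_inner m v g)"

definition l2_closure :: "'a measure \<Rightarrow> ('a \<Rightarrow> real) set \<Rightarrow> ('a \<Rightarrow> real) set" where
  "l2_closure m S =
     {f \<in> l2_space m. \<forall>e>0. \<exists>g\<in>S. l2_norm m (\<lambda>x. f x - g x) < e}"

(* Orthogonal projection onto a closed subspace S; the value is determined almost everywhere. *)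
definition l2_proj :: "'a measure \<Rightarrow> ('a \<Rightarrow> real) set \<Rightarrow> ('a \<Rightarrow> real) \<Rightarrow> ('a \<Rightarrow> real)" where
  "l2_proj m S f = (SOME v. v \<in> S \<and> (\<forall>w\<in>S. l2_inner m (\<lambda>x. f x - v x) w = 0))"

(* The L2-valued integral of u over [0,T], as the limit in L2 norm of Riemann sums. This is
   has_integral on a compact interval, with the L2 seminorm as the norm of the target space. *)
definition l2_has_integral_upto ::
  "'a measure \<Rightarrow> (real \<Rightarrow> 'a \<Rightarrow> real) \<Rightarrow> ('a \<Rightarrow> real) \<Rightarrow> real \<Rightarrow> bool" where
  "l2_has_integral_upto m u v T \<longleftrightarrow>
     v \<in> l2_space m \<and>
     ((\<lambda>p. l2_norm m (\<lambda>x. (\<Sum>(t,K)\<in>p. measure lborel K * u t x) - v x)) \<longlongrightarrow> 0)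
       (division_filter (cbox 0 T))"

(* The improper L2-valued integral over the half line [0,\<infinity>). *)
definition l2_has_integral_halfline ::
  "'a measure \<Rightarrow> (real \<Rightarrow> 'a \<Rightarrow> real) \<Rightarrow> ('a \<Rightarrow> real) \<Rightarrow> bool" where
  "l2_has_integral_halfline m u v \<longleftrightarrow>
     v \<in> l2_space m \<and>
     (\<exists>w. (\<forall>T\<ge>0. l2_has_integral_upto m u (w T) T) \<and>
          ((\<lambda>T. l2_norm m (\<lambda>x. w T x - v x)) \<longlongrightarrow> 0) at_top)"


section \<open>Closed symmetric forms, not necessarily densely defined\<close>

definition form_alpha ::
  "'a measure \<Rightarrow> (('a \<Rightarrow> real) \<Rightarrow> ('a \<Rightarrow> real) \<Rightarrow> real) \<Rightarrow> real
     \<Rightarrow> ('a \<Rightarrow> real) \<Rightarrow> ('a \<Rightarrow> real) \<Rightarrow> real" where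
  "form_alpha m \<E> \<alpha> f g = \<E> f g + \<alpha> * l2_inner m f g"

(* The second and sixth clauses say that the domain and the form depend on functions only through
   their classes modulo equality almost everywhere. The last one is completeness for the inner
   product form_alpha m \<E> 1, whose positive definiteness on classes is automatic. Values of the
   form outside the domain are irrelevant. *)
definition closed_symmetric_form ::
  "'a measure \<Rightarrow> (('a \<Rightarrow> real) \<Rightarrow> ('a \<Rightarrow> real) \<Rightarrow> real) \<Rightarrow> ('a \<Rightarrow> real) set \<Rightarrow> bool" where
  "closed_symmetric_form m \<E> \<F> \<longleftrightarrow>
     \<F> \<subseteq> l2_space m \<and>
     (\<forall>f\<in>\<F>. \<forall>g\<in>l2_space m. (AE x in m. f x = g x) \<longrightarrow> g \<in> \<F>) \<and>
     (\<lambda>x. 0) \<in> \<F> \<and>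
     (\<forall>f\<in>\<F>. \<forall>g\<in>\<F>. (\<lambda>x. f x + g x) \<in> \<F>) \<and>
     (\<forall>f\<in>\<F>. \<forall>c. (\<lambda>x. c * f x) \<in> \<F>) \<and>
     (\<forall>f\<in>\<F>. \<forall>f'\<in>\<F>. \<forall>g\<in>\<F>. (AE x in m. f x = f' x) \<longrightarrow> \<E> f g = \<E> f' g) \<and>
     (\<forall>f\<in>\<F>. \<forall>g\<in>\<F>. \<E> f g = \<E> g f) \<and>
     (\<forall>f\<in>\<F>. \<forall>f'\<in>\<F>. \<forall>g\<in>\<F>. \<E> (\<lambda>x. f x + f' x) g = \<E> f g + \<E> f' g) \<and>
     (\<forall>f\<in>\<F>. \<forall>g\<in>\<F>. \<forall>c. \<E> (\<lambda>x. c * f x) g = c * \<E> f g) \<and>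
     (\<forall>f\<in>\<F>. \<E> f f \<ge> 0) \<and>
     (\<forall>u. (\<forall>n::nat. u n \<in> \<F>) \<and>
          (\<forall>e>0. \<exists>N. \<forall>i\<ge>N. \<forall>j\<ge>N.
             sqrt (form_alpha m \<E> 1 (\<lambda>x. u i x - u j x) (\<lambda>x. u i x - u j x)) < e)
        \<longrightarrow> (\<exists>v\<in>\<F>. (\<lambda>n. sqrt (form_alpha m \<E> 1 (\<lambda>x. u n x - v x) (\<lambda>x. u n x - v x)))
                  \<longlonglongrightarrow> 0))"

definition form_energy ::
  "(('a \<Rightarrow> real) \<Rightarrow> ('a \<Rightarrow> real) \<Rightarrow> real) \<Rightarrow> ('a \<Rightarrow> real) set \<Rightarrow> ('a \<Rightarrow> real) \<Rightarrow> ereal" where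
  "form_energy \<E> \<F> u = (if u \<in> \<F> then ereal (\<E> u u) else \<infinity>)"

(* Defined for f in the closure of the domain; the value is determined almost everywhere. *)
definition form_resolvent ::
  "'a measure \<Rightarrow> (('a \<Rightarrow> real) \<Rightarrow> ('a \<Rightarrow> real) \<Rightarrow> real) \<Rightarrow> ('a \<Rightarrow> real) set
     \<Rightarrow> real \<Rightarrow> ('a \<Rightarrow> real) \<Rightarrow> ('a \<Rightarrow> real)" where
  "form_resolvent m \<E> \<F> \<alpha> f =
     (SOME u. u \<in> \<F> \<and> (\<forall>g\<in>\<F>. form_alpha m \<E> \<alpha> u g = l2_inner m f g))"

(* Strongly continuous contraction symmetric semigroups of linear operators on a closed subspace H.
   Compatibility of P t with equality almost everywhere follows from linearity and contraction. *)
definition symmetric_contraction_semigroup ::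
  "'a measure \<Rightarrow> ('a \<Rightarrow> real) set \<Rightarrow> (real \<Rightarrow> ('a \<Rightarrow> real) \<Rightarrow> ('a \<Rightarrow> real)) \<Rightarrow> bool" where
  "symmetric_contraction_semigroup m H P \<longleftrightarrow>
     (\<forall>t\<ge>0. \<forall>f\<in>H. P t f \<in> H) \<and>
     (\<forall>t\<ge>0. \<forall>f\<in>H. \<forall>g\<in>H. \<forall>a b.
        AE x in m. P t (\<lambda>y. a * f y + b * g y) x = a * P t f x + b * P t g x) \<and>
     (\<forall>f\<in>H. AE x in m. P 0 f x = f x) \<and>
     (\<forall>s\<ge>0. \<forall>t\<ge>0. \<forall>f\<in>H. AE x in m. P (s + t) f x = P s (P t f) x) \<and>
     (\<forall>t\<ge>0. \<forall>f\<in>H. l2_norm m (P t f) \<le> l2_norm m f) \<and>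
     (\<forall>t\<ge>0. \<forall>f\<in>H. \<forall>g\<in>H. l2_inner m (P t f) g = l2_inner m f (P t g)) \<and>
     (\<forall>f\<in>H. ((\<lambda>t. l2_norm m (\<lambda>x. P t f x - f x)) \<longlongrightarrow> 0) (at_right 0))"

(* P is the semigroup on the closure of the domain whose Laplace transform is the resolvent
   of the form. These conditions determine P t f almost everywhere. *)
definition associated_semigroup ::
  "'a measure \<Rightarrow> (('a \<Rightarrow> real) \<Rightarrow> ('a \<Rightarrow> real) \<Rightarrow> real) \<Rightarrow> ('a \<Rightarrow> real) set
     \<Rightarrow> (real \<Rightarrow> ('a \<Rightarrow> real) \<Rightarrow> ('a \<Rightarrow> real)) \<Rightarrow> bool" where
  "associated_semigroup m \<E> \<F> P \<longleftrightarrow>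
     symmetric_contraction_semigroup m (l2_closure m \<F>) P \<and>
     (\<forall>\<alpha>>0. \<forall>f\<in>l2_closure m \<F>.
        l2_has_integral_halfline m (\<lambda>t x. exp (- \<alpha> * t) * P t f x) (form_resolvent m \<E> \<F> \<alpha> f))"

definition mosco_converges ::
  "'a measure \<Rightarrow> (nat \<Rightarrow> ('a \<Rightarrow> real) \<Rightarrow> ('a \<Rightarrow> real) \<Rightarrow> real) \<Rightarrow> (nat \<Rightarrow> ('a \<Rightarrow> real) set)
     \<Rightarrow> (('a \<Rightarrow> real) \<Rightarrow> ('a \<Rightarrow> real) \<Rightarrow> real) \<Rightarrow> ('a \<Rightarrow> real) set \<Rightarrow> bool" where
  "mosco_converges m \<E>n \<F>n \<E> \<F> \<longleftrightarrow>
     (\<forall>u v. (\<forall>n. u n \<in> l2_space m) \<and> v \<in> l2_space m \<and> l2_weak_tendsto m u v \<longrightarrow>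
        liminf (\<lambda>n. form_energy (\<E>n n) (\<F>n n) (u n)) \<ge> form_energy \<E> \<F> v) \<and>
     (\<forall>v\<in>l2_space m. \<exists>u. (\<forall>n. u n \<in> l2_space m) \<and> l2_tendsto m u v \<and>
        limsup (\<lambda>n. form_energy (\<E>n n) (\<F>n n) (u n)) \<le> form_energy \<E> \<F> v)"

end

theory Submission
  imports Defs "HOL-Library.Function_Algebras"
begin

text \<open>
  The proof runs through the scalars \<open>(f, G\<^sub>\<alpha> f) = sup (2 (f, v) - \<E>\<^sub>\<alpha>(v, v))\<close> for \<open>f\<close> in the closure of
  the domain. On the one hand they are the Laplace transforms of the continuous decreasing functions
  \<open>t \<mapsto> (P\<^sub>t f, f) = \<parallel>P\<^bsub>t/2\<^esub> f\<parallel>\<^sup>2\<close>, so by the continuity theorem for Laplace transforms their convergence for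
  all \<open>\<alpha>\<close> is the pointwise convergence of these functions; polarization and
  \<open>\<parallel>P\<^sup>n\<^sub>t f - P\<^sub>t f\<parallel>\<^sup>2 = (P\<^sup>n\<^bsub>2t\<^esub> f, f) - 2 (P\<^sup>n\<^sub>t f, P\<^sub>t f) + \<parallel>P\<^sub>t f\<parallel>\<^sup>2\<close> turn that into strong convergence of
  the semigroups. On the other hand their convergence follows from Mosco convergence, since they are optimal
  values of variational problems, and it implies Mosco convergence: the minimizers of
  \<open>\<E>\<^sup>n(u, u) + \<beta> \<parallel>u - v\<parallel>\<^sup>2\<close> give recovery sequences, and the lower bound comes from the dual description
  \<open>\<E>\<^sub>\<beta>(v, v) = sup (2 (f, v) - (f, G\<^sub>\<beta> f))\<close>. Convergence of the projections is needed only to see that weak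
  limits of bounded-energy sequences lie in the closure of the limit domain.
\<close>

section \<open>Complete semi-inner product spaces\<close>

text \<open>Functions that agree almost everywhere are not identified, so neither
  \<open>l2_space m\<close> nor \<open>\<F>\<close> is an instance of a Hilbert space class. The
  geometry is therefore developed for a carrier set and a form that may vanish on nonzero vectors.
  It serves \<open>l2_inner m\<close> on \<open>l2_space m\<close> and
  \<open>form_alpha m \<E> \<alpha>\<close> on \<open>\<F>\<close>; completeness of the latter is
  what closedness of the form means. The obstacle is that the operators live on spaces that vary
  with n, while Mosco convergence offers only inequalities between energies. An optimal value is a
  number attached to one f, hence comparable across all forms, and each of the two Mosco conditions
  bounds it from one side. The inclusion of the closures lets the same f serve every n. Convergence
  of Laplace transforms controls only averages in t. Monotonicity of the diagonal functions traps a
  value at t between averages taken just before and just after t, and continuity of the limit closes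
  the gap.\<close>

locale semi_inner_space =
  fixes V :: "'v::real_vector set" and ip :: "'v \<Rightarrow> 'v \<Rightarrow> real"
  assumes subspace: "subspace V"
    and ip_commute: "x \<in> V \<Longrightarrow> y \<in> V \<Longrightarrow> ip x y = ip y x"
    and ip_add_left: "x \<in> V \<Longrightarrow> y \<in> V \<Longrightarrow> z \<in> V \<Longrightarrow> ip (x + y) z = ip x z + ip y z"
    and ip_scale_left: "x \<in> V \<Longrightarrow> z \<in> V \<Longrightarrow> ip (c *\<^sub>R x) z = c * ip x z"
    and ip_nonneg: "x \<in> V \<Longrightarrow> 0 \<le> ip x x"
begin

definition nrm :: "'v \<Rightarrow> real" where "nrm x = sqrt (ip x x)"

lemma mem [simp, intro]:
  "0 \<in> V" "x \<in> V \<Longrightarrow> y \<in> V \<Longrightarrow> x + y \<in> V" "x \<in> V \<Longrightarrow> y \<in> V \<Longrightarrow> x - y \<in> V" "x \<in> V \<Longrightarrow> c *\<^sub>R x \<in> V"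
  using subspace by (auto simp: subspace_0 subspace_add subspace_diff subspace_scale)

lemma ip_add_right: "x \<in> V \<Longrightarrow> y \<in> V \<Longrightarrow> z \<in> V \<Longrightarrow> ip z (x + y) = ip z x + ip z y"
  by (metis ip_commute ip_add_left mem(2))

lemma ip_scale_right: "x \<in> V \<Longrightarrow> z \<in> V \<Longrightarrow> ip z (c *\<^sub>R x) = c * ip z x"
  by (metis ip_commute ip_scale_left mem(4))

lemma ip_diff_left: "x \<in> V \<Longrightarrow> y \<in> V \<Longrightarrow> z \<in> V \<Longrightarrow> ip (x - y) z = ip x z - ip y z"
  by (metis add_diff_cancel_right' diff_add_cancel ip_add_left mem(3))

lemma ip_diff_right: "x \<in> V \<Longrightarrow> y \<in> V \<Longrightarrow> z \<in> V \<Longrightarrow> ip z (x - y) = ip z x - ip z y"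
  by (metis ip_commute ip_diff_left mem(3))

lemma ip_zero_left: "z \<in> V \<Longrightarrow> ip 0 z = 0"
  using ip_scale_left[of 0 z 0] by simp

lemma ip_zero_right: "z \<in> V \<Longrightarrow> ip z 0 = 0"
  using ip_scale_right[of 0 z 0] by simp

lemmas ip_simps = ip_add_left ip_add_right ip_scale_left ip_scale_right ip_diff_left ip_diff_right
  ip_zero_left ip_zero_right

lemma nrm_nonneg [simp]: "x \<in> V \<Longrightarrow> 0 \<le> nrm x"
  by (simp add: nrm_def ip_nonneg)

lemma nrm_zero [simp]: "nrm 0 = 0"
  by (simp add: nrm_def ip_zero_left)

lemma nrm_square: "x \<in> V \<Longrightarrow> (nrm x)\<^sup>2 = ip x x"
  by (simp add: nrm_def ip_nonneg)

lemma nrm_scale: "x \<in> V \<Longrightarrow> nrm (c *\<^sub>R x) = \<bar>c\<bar> * nrm x"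
  by (simp add: nrm_def ip_simps real_sqrt_mult power2_eq_square[symmetric] mult.assoc[symmetric])

lemma nrm_minus_commute: "x \<in> V \<Longrightarrow> y \<in> V \<Longrightarrow> nrm (x - y) = nrm (y - x)"
  by (simp add: nrm_def ip_simps)

lemma Cauchy_Schwarz:
  assumes x: "x \<in> V" and y: "y \<in> V"
  shows "\<bar>ip x y\<bar> \<le> nrm x * nrm y"
proof -
  have Q: "0 \<le> ip x x - 2 * t * ip x y + t\<^sup>2 * ip y y" for t
    using ip_nonneg[of "x - t *\<^sub>R y"] x y
    by (simp add: ip_simps ip_commute[of y x] power2_eq_square algebra_simps)
  have "(ip x y)\<^sup>2 \<le> ip x x * ip y y"
  proof (cases "ip y y = 0")
    case True
    have "ip x y = 0"
    proof (rule ccontr)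
      assume "ip x y \<noteq> 0"
      then show False
        \<comment> \<open>With \<open>ip y y = 0\<close> the polynomial in \<open>Q\<close> is
          affine in t; this t gives it the value -1.\<close>
        using Q[of "(ip x x + 1) / (2 * ip x y)"] True by simp
    qed
    then show ?thesis using True by simp
  next
    case False
    then have "0 < ip y y" using ip_nonneg[OF y] by simp
    then show ?thesis using Q[of "ip x y / ip y y"]
      by (simp add: power2_eq_square field_simps)
  qed
  then have "sqrt ((ip x y)\<^sup>2) \<le> sqrt (ip x x * ip y y)" by (rule real_sqrt_le_mono)
  then show ?thesis by (simp add: nrm_def real_sqrt_mult)
qed

lemma nrm_triangle:
  assumes x: "x \<in> V" and y: "y \<in> V"
  shows "nrm (x + y) \<le> nrm x + nrm y"
proof (rule power2_le_imp_le)
  have "(nrm (x + y))\<^sup>2 = (nrm x)\<^sup>2 + 2 * ip x y + (nrm y)\<^sup>2"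
    using x y by (simp add: nrm_square ip_simps ip_commute[of y x])
  also have "\<dots> \<le> (nrm x)\<^sup>2 + 2 * (nrm x * nrm y) + (nrm y)\<^sup>2"
    using Cauchy_Schwarz[OF x y] by simp
  also have "\<dots> = (nrm x + nrm y)\<^sup>2" by (simp add: power2_eq_square algebra_simps)
  finally show "(nrm (x + y))\<^sup>2 \<le> (nrm x + nrm y)\<^sup>2" .
  show "0 \<le> nrm x + nrm y" using x y by simp
qed

lemma nrm_triangle_diff:
  assumes "x \<in> V" "y \<in> V" "z \<in> V"
  shows "nrm (x - z) \<le> nrm (x - y) + nrm (y - z)"
  using nrm_triangle[of "x - y" "y - z"] assms by simp

lemma nrm_triangle_diff': "x \<in> V \<Longrightarrow> y \<in> V \<Longrightarrow> nrm x \<le> nrm (x - y) + nrm y"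
  using nrm_triangle[of "x - y" y] by simp

lemma ip_null_left: "nrm x = 0 \<Longrightarrow> x \<in> V \<Longrightarrow> y \<in> V \<Longrightarrow> ip x y = 0"
  using Cauchy_Schwarz[of x y] by simp

lemma ip_cong_left: "nrm (x - y) = 0 \<Longrightarrow> x \<in> V \<Longrightarrow> y \<in> V \<Longrightarrow> z \<in> V \<Longrightarrow> ip x z = ip y z"
  using ip_null_left[of "x - y" z] by (simp add: ip_simps)

lemma tendsto_ip_left:
  assumes u: "\<And>n. u n \<in> V" "v \<in> V" "w \<in> V" and lim: "((\<lambda>n. nrm (u n - v)) \<longlongrightarrow> 0) G"
  shows "((\<lambda>n. ip (u n) w) \<longlongrightarrow> ip v w) G"
proof (rule Lim_transform)
  show "((\<lambda>n. ip v w) \<longlongrightarrow> ip v w) G" by simp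
  have "((\<lambda>n. nrm (u n - v) * nrm w) \<longlongrightarrow> 0) G" using tendsto_mult_left_zero[OF lim] .
  then show "((\<lambda>n. ip (u n) w - ip v w) \<longlongrightarrow> 0) G"
    by (rule tendsto_0_le[where K=1])
       (use Cauchy_Schwarz[of "u _ - v" w] u in \<open>auto simp: ip_simps abs_minus_commute intro!: always_eventually\<close>)
qed

lemma tendsto_nrm:
  assumes u: "\<And>n. u n \<in> V" "v \<in> V" and lim: "((\<lambda>n. nrm (u n - v)) \<longlongrightarrow> 0) G"
  shows "((\<lambda>n. nrm (u n)) \<longlongrightarrow> nrm v) G"
proof (rule Lim_transform)
  show "((\<lambda>n. nrm v) \<longlongrightarrow> nrm v) G" by simp
  have "\<bar>nrm (u n) - nrm v\<bar> \<le> nrm (u n - v)" for n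
    using nrm_triangle_diff'[of v "u n"] nrm_triangle_diff'[of "u n" v] nrm_minus_commute[of v "u n"] u
    by auto
  then show "((\<lambda>n. nrm (u n) - nrm v) \<longlongrightarrow> 0) G"
    by (intro tendsto_0_le[where K=1, OF lim] always_eventually) (auto intro: order_trans[OF _ abs_ge_self])
qed

lemma tendsto_ip_self:
  assumes u: "\<And>n. u n \<in> V" "v \<in> V" and lim: "((\<lambda>n. nrm (u n - v)) \<longlongrightarrow> 0) G"
  shows "((\<lambda>n. ip (u n) (u n)) \<longlongrightarrow> ip v v) G"
  using tendsto_power[OF tendsto_nrm[OF u lim], of 2] u by (simp add: nrm_square)

end

section \<open>Theorems that rest on completeness\<close>

locale semi_hilbert = semi_inner_space +
  assumes complete: "\<And>u. (\<And>n::nat. u n \<in> V) \<Longrightarrow>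
    (\<forall>e>0. \<exists>N. \<forall>i\<ge>N. \<forall>j\<ge>N. nrm (u i - u j) < e) \<Longrightarrow> \<exists>v\<in>V. (\<lambda>n. nrm (u n - v)) \<longlonglongrightarrow> 0"
begin

text \<open>The direct method: the representing vector minimizes
  \<open>J v = ip v v - 2 * \<phi> v\<close>. Minimizing sequences are Cauchy by the parallelogram
  law, and the vanishing first variation at the minimizer is the representation.\<close>

theorem riesz_representation:
  assumes add: "\<And>x y. x \<in> V \<Longrightarrow> y \<in> V \<Longrightarrow> \<phi> (x + y) = \<phi> x + \<phi> y"
    and scale: "\<And>x c. x \<in> V \<Longrightarrow> \<phi> (c *\<^sub>R x) = c * \<phi> x"
    and bdd: "\<And>x. x \<in> V \<Longrightarrow> \<bar>\<phi> x\<bar> \<le> C * nrm x"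
  shows "\<exists>v\<in>V. \<forall>x\<in>V. ip v x = \<phi> x"
proof -
  define J where "J v = ip v v - 2 * \<phi> v" for v
  have J_ge: "- C\<^sup>2 \<le> J v" if "v \<in> V" for v
  proof -
    have "0 \<le> (nrm v - C)\<^sup>2" by simp
    then show ?thesis
      using bdd[OF that] nrm_square[OF that] by (simp add: J_def power2_eq_square algebra_simps)
  qed
  define d where "d = (INF v\<in>V. J v)"
  have bb: "bdd_below (J ` V)" using J_ge by (auto intro!: bdd_belowI[of _ "- C\<^sup>2"])
  have d_le: "d \<le> J v" if "v \<in> V" for v
    unfolding d_def by (rule cINF_lower[OF bb that])
  have "\<exists>v\<in>V. J v < d + 1 / real (Suc n)" for n
    using cINF_less_iff[of V J "d + 1 / real (Suc n)"] bb mem(1) unfolding d_def by fastforce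
  then obtain u where u: "\<And>n. u n \<in> V" and Ju: "\<And>n. J (u n) < d + 1 / real (Suc n)"
    by metis
  \<comment> \<open>The parallelogram law for \<open>J\<close>: its linear part cancels at the
    midpoint, and the value there is at least \<open>d\<close>.\<close>
  have diff: "(nrm (x - y))\<^sup>2 \<le> 2 * (J x + J y - 2 * d)" if "x \<in> V" "y \<in> V" for x y
  proof -
    have "\<phi> ((1/2) *\<^sub>R (x + y)) = (\<phi> x + \<phi> y) / 2"
      using that scale[of "x + y" "1/2"] add[of x y] by simp
    then have "J x + J y - 2 * J ((1/2) *\<^sub>R (x + y)) = (nrm (x - y))\<^sup>2 / 2"
      using that by (simp add: J_def nrm_square ip_simps ip_commute[of y x] field_simps)
    then show ?thesis using d_le[of "(1/2) *\<^sub>R (x + y)"] that by simp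
  qed
  have "\<exists>v\<in>V. (\<lambda>n. nrm (u n - v)) \<longlonglongrightarrow> 0"
  proof (rule complete[OF u], intro allI impI)
    fix e :: real assume e: "0 < e"
    obtain N where N: "1 / real (Suc N) < e\<^sup>2 / 4"
      using reals_Archimedean[of "e\<^sup>2 / 4"] e by (auto simp: inverse_eq_divide)
    have "nrm (u i - u j) < e" if "i \<ge> N" "j \<ge> N" for i j
    proof (rule power2_less_imp_less)
      have "1 / real (Suc i) \<le> 1 / real (Suc N)" "1 / real (Suc j) \<le> 1 / real (Suc N)"
        using that by (auto intro!: divide_left_mono)
      then have "J (u i) < d + e\<^sup>2 / 4" "J (u j) < d + e\<^sup>2 / 4"
        using Ju[of i] Ju[of j] N by auto
      then show "(nrm (u i - u j))\<^sup>2 < e\<^sup>2"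
        using diff[OF u u, of i j] by argo
    qed (use e in simp)
    then show "\<exists>N. \<forall>i\<ge>N. \<forall>j\<ge>N. nrm (u i - u j) < e" by blast
  qed
  then obtain v where v: "v \<in> V" and lim: "(\<lambda>n. nrm (u n - v)) \<longlonglongrightarrow> 0" by blast
  have "(\<lambda>n. \<phi> (u n) - \<phi> v) \<longlonglongrightarrow> 0"
  proof (rule tendsto_0_le[OF lim, of _ C], intro always_eventually allI)
    fix n
    have "\<phi> (u n - v) = \<phi> (u n) - \<phi> v" using add[of "u n - v" v] u v by simp
    then show "norm (\<phi> (u n) - \<phi> v) \<le> norm (nrm (u n - v)) * C"
      using bdd[of "u n - v"] u v by (simp add: mult.commute)
  qed
  then have "(\<lambda>n. \<phi> (u n)) \<longlonglongrightarrow> \<phi> v" by (simp add: LIM_zero_iff)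
  then have JJ: "(\<lambda>n. J (u n)) \<longlonglongrightarrow> J v"
    unfolding J_def by (intro tendsto_intros tendsto_ip_self u v lim)
  have "(\<lambda>n. d + 1 / real (Suc n)) \<longlonglongrightarrow> d"
    using tendsto_add[OF tendsto_const LIMSEQ_Suc[OF lim_1_over_n], of d] by simp
  then have "J v \<le> d"
    by (rule LIMSEQ_le[OF JJ]) (use Ju less_imp_le in blast)
  have "ip v x = \<phi> x" if x: "x \<in> V" for x
  proof (rule ccontr)
    assume "ip v x \<noteq> \<phi> x"
    define a where "a = ip v x - \<phi> x"
    define b where "b = ip x x"
    have "a \<noteq> 0" and "b \<ge> 0" using \<open>ip v x \<noteq> \<phi> x\<close> ip_nonneg[OF x] by (auto simp: a_def b_def)
    have "0 \<le> 2 * t * a + t\<^sup>2 * b" for t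
      using d_le[of "v + t *\<^sub>R x"] \<open>J v \<le> d\<close> v x add[of v "t *\<^sub>R x"] scale[of x t]
      by (simp add: J_def ip_simps a_def b_def ip_commute[of x v] power2_eq_square algebra_simps)
    \<comment> \<open>Close to the minimizing value - a / b, with \<open>b + 1\<close> in place of
      \<open>b\<close> so that \<open>b = 0\<close> needs no separate case.\<close>
    from this[of "- a / (b + 1)"] have "0 \<le> (b + 1)\<^sup>2 * (2 * (- a / (b + 1)) * a + (- a / (b + 1))\<^sup>2 * b)"
      by simp
    also have "\<dots> = - (a\<^sup>2 * (b + 2))"
      using \<open>b \<ge> 0\<close> by (simp add: power2_eq_square divide_simps) (simp add: algebra_simps)
    finally show False using \<open>a \<noteq> 0\<close> \<open>b \<ge> 0\<close>
      by (smt (verit) mult_pos_pos zero_less_power2)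
  qed
  then show ?thesis using v by blast
qed

text \<open>A closed \<open>S\<close> is itself complete, so the functional \<open>ip x\<close>
  restricted to \<open>S\<close> is represented by some p in \<open>S\<close>; that is the
  orthogonality of \<open>x - p\<close> to \<open>S\<close>. Closedness refers to limits in the
  seminorm, so \<open>S\<close> also contains every vector of \<open>V\<close> at distance 0 from
  one of its members.\<close>

theorem projection:
  assumes S: "subspace S" "S \<subseteq> V"
    and closed: "\<And>u v. (\<And>n::nat. u n \<in> S) \<Longrightarrow> v \<in> V \<Longrightarrow> (\<lambda>n. nrm (u n - v)) \<longlonglongrightarrow> 0 \<Longrightarrow> v \<in> S"
    and x: "x \<in> V"
  shows "\<exists>p\<in>S. \<forall>w\<in>S. ip (x - p) w = 0"
proof -
  interpret S: semi_inner_space S ip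
    using S by unfold_locales (auto simp: subset_iff intro: ip_commute ip_add_left ip_scale_left ip_nonneg)
  interpret S: semi_hilbert S ip
  proof
    fix u assume u: "\<And>n::nat. u n \<in> S" and c: "\<forall>e>0. \<exists>N. \<forall>i\<ge>N. \<forall>j\<ge>N. S.nrm (u i - u j) < e"
    have "u n \<in> V" for n using u S(2) by (rule subsetD[rotated])
    from complete[OF this c] obtain v where v: "v \<in> V" "(\<lambda>n. nrm (u n - v)) \<longlonglongrightarrow> 0" ..
    show "\<exists>v\<in>S. (\<lambda>n. S.nrm (u n - v)) \<longlonglongrightarrow> 0"
      by (rule bexI[of _ v]) (fact v(2), fact closed[OF u v])
  qed
  have "\<exists>p\<in>S. \<forall>w\<in>S. ip p w = ip x w"
    by (rule S.riesz_representation[where C="nrm x"])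
       (use S x Cauchy_Schwarz[OF x] in \<open>auto simp: ip_simps subset_iff\<close>)
  then show ?thesis using S(2) x by (metis cancel_comm_monoid_add_class.diff_cancel ip_diff_left subsetD)
qed

text \<open>Row n of the matrix \<open>ip (u n) (u k)\<close> is a point of a countable product of
  compact intervals, whose sequential compactness does the diagonal extraction. Projection extends
  convergence from the \<open>u k\<close> to all test vectors, and the limit functional is bounded,
  hence represented by a vector.\<close>

theorem weak_sequential_compactness:
  assumes u: "\<And>n::nat. u n \<in> V" and bdd: "\<And>n. nrm (u n) \<le> M"
  obtains r v where "strict_mono (r::nat\<Rightarrow>nat)" "v \<in> V" "\<And>w. w \<in> V \<Longrightarrow> (\<lambda>n. ip (u (r n)) w) \<longlonglongrightarrow> ip v w"
proof -
  have M: "0 \<le> M" using bdd[of 0] nrm_nonneg[OF u, of 0] by linarith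
  have ip_le: "\<bar>ip (u n) w\<bar> \<le> M * nrm w" if "w \<in> V" for n w
    using Cauchy_Schwarz[OF u that, of n] mult_right_mono[OF bdd nrm_nonneg[OF that], of n] by linarith
  let ?K = "Pi\<^sub>E UNIV (\<lambda>k::nat. {- (M * M)..M * M})"
  have "compact ?K"
    using compactin_PiE[of "\<lambda>_. euclidean" UNIV "\<lambda>k::nat. {- (M * M)..M * M}"]
    by (simp add: euclidean_product_topology)
  moreover have "(\<lambda>k. ip (u n) (u k)) \<in> ?K" for n
  proof -
    have "\<bar>ip (u n) (u k)\<bar> \<le> M * M" for k
      using ip_le[OF u, of n k] mult_left_mono[OF bdd M, of k] by linarith
    then show ?thesis by (auto simp: abs_le_iff minus_le_iff)
  qed
  ultimately obtain l r where r: "strict_mono (r::nat\<Rightarrow>nat)" and "((\<lambda>n k. ip (u n) (u k)) \<circ> r) \<longlonglongrightarrow> l"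
    using seq_compactE[OF compact_imp_seq_compact, of ?K "\<lambda>n k. ip (u n) (u k)"] by metis
  then have lim: "(\<lambda>n. ip (u (r n)) (u k)) \<longlonglongrightarrow> l k" for k
    using continuous_on_tendsto_compose[of UNIV "\<lambda>f. f k" "(\<lambda>n k. ip (u n) (u k)) \<circ> r" l sequentially]
    by (simp add: o_def continuous_on_product_coordinates)
  txt \<open>The vectors whose products with the subsequence converge form a closed subspace containing every
    \<open>u k\<close>; a vector orthogonal to it is orthogonal to every \<open>u k\<close>, so belongs to it as well.\<close>
  define W where "W = {w \<in> V. convergent (\<lambda>n. ip (u (r n)) w)}"
  have "subspace W"
    unfolding W_def using u
    by (auto simp: subspace_def ip_simps convergent_const intro!: convergent_add convergent_mult)
  moreover have "W \<subseteq> V" by (auto simp: W_def)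
  moreover have "v \<in> W" if w: "\<And>n::nat. w n \<in> W" and v: "v \<in> V" and wv: "(\<lambda>n. nrm (w n - v)) \<longlonglongrightarrow> 0" for w v
  proof -
    have "Cauchy (\<lambda>n. ip (u (r n)) v)"
    proof (rule CauchyI)
      fix e :: real assume e: "0 < e"
      have "\<forall>\<^sub>F k in sequentially. nrm (w k - v) < e / (3 * (M + 1))"
        using order_tendstoD(2)[OF wv, of "e / (3 * (M + 1))"] e M by simp
      then obtain k where k: "nrm (w k - v) < e / (3 * (M + 1))"
        by (auto dest: eventually_happens)
      have wk: "w k \<in> V" using w by (simp add: W_def)
      have "M * nrm (w k - v) \<le> (M + 1) * nrm (w k - v)"
        using wk v by (simp add: algebra_simps)
      also have "\<dots> < e / 3" using k M e by (simp add: field_simps)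
      finally have small: "\<bar>ip (u n) (w k) - ip (u n) v\<bar> < e / 3" for n
        using ip_le[of "w k - v" n] wk v u by (simp add: ip_simps)
      have "Cauchy (\<lambda>n. ip (u (r n)) (w k))"
        using w by (simp add: W_def Cauchy_convergent_iff)
      then obtain N where N: "\<And>i j. i \<ge> N \<Longrightarrow> j \<ge> N \<Longrightarrow> norm (ip (u (r i)) (w k) - ip (u (r j)) (w k)) < e / 3"
        using CauchyD[of _ "e / 3"] e by (metis divide_pos_pos zero_less_numeral)
      have "norm (ip (u (r i)) v - ip (u (r j)) v) < e" if "i \<ge> N" "j \<ge> N" for i j
        using N[OF that] small[of "r i"] small[of "r j"] unfolding real_norm_def abs_less_iff by argo
      then show "\<exists>N. \<forall>i\<ge>N. \<forall>j\<ge>N. norm (ip (u (r i)) v - ip (u (r j)) v) < e" by blast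
    qed
    then show ?thesis using v by (simp add: W_def Cauchy_convergent_iff)
  qed
  ultimately have proj: "\<exists>p\<in>W. \<forall>w\<in>W. ip (x - p) w = 0" if "x \<in> V" for x
    using projection that by metis
  have uW: "u k \<in> W" for k using lim u by (auto simp: W_def convergent_def)
  have conv: "convergent (\<lambda>n. ip (u (r n)) x)" if x: "x \<in> V" for x
  proof -
    obtain p where p: "p \<in> W" "\<And>w. w \<in> W \<Longrightarrow> ip (x - p) w = 0" using proj[OF x] by blast
    then have "ip (u (r n)) x = ip (u (r n)) p" for n
      using p(2)[OF uW, of "r n"] u x by (simp add: W_def ip_simps ip_commute[of _ "u (r n)"])
    then show ?thesis using p(1) by (simp add: W_def)
  qed
  define \<phi> where "\<phi> w = lim (\<lambda>n. ip (u (r n)) w)" for w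
  have \<phi>: "(\<lambda>n. ip (u (r n)) w) \<longlonglongrightarrow> \<phi> w" if "w \<in> V" for w
    using conv[OF that] by (simp add: \<phi>_def convergent_LIMSEQ_iff)
  have "\<exists>v\<in>V. \<forall>x\<in>V. ip v x = \<phi> x"
  proof (rule riesz_representation)
    show "\<phi> (x + y) = \<phi> x + \<phi> y" if "x \<in> V" "y \<in> V" for x y
      using tendsto_add[OF \<phi> \<phi>, of x y] \<phi>[of "x + y"] that u
      by (auto simp: ip_simps intro: LIMSEQ_unique)
    show "\<phi> (c *\<^sub>R x) = c * \<phi> x" if "x \<in> V" for x c
      using tendsto_mult_left[OF \<phi>, of x c] \<phi>[of "c *\<^sub>R x"] that u
      by (auto simp: ip_simps intro: LIMSEQ_unique)
    show "\<bar>\<phi> x\<bar> \<le> M * nrm x" if "x \<in> V" for x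
      by (rule LIMSEQ_le_const2[OF tendsto_rabs[OF \<phi>[OF that]]]) (use ip_le[OF that] in blast)
  qed
  then obtain v where v: "v \<in> V" "\<And>x. x \<in> V \<Longrightarrow> ip v x = \<phi> x" by blast
  show thesis by (rule that[OF r v(1)]) (use \<phi> v in simp)
qed

text \<open>The gliding hump argument: a partial sum is corrected by \<open>\<plusminus>3\<^sup>-\<^sup>k\<close> times a unit vector, with the sign
  for which the product with the \<open>k\<close>-th chosen vector cannot cancel.\<close>

theorem uniform_boundedness:
  assumes u: "\<And>n::nat. u n \<in> V" and bdd: "\<And>w. w \<in> V \<Longrightarrow> Bseq (\<lambda>n. ip (u n) w)"
  obtains M where "\<And>n. nrm (u n) \<le> M"
proof (rule ccontr)
  assume "\<not> thesis"
  then have "\<nexists>M. \<forall>n. nrm (u n) \<le> M" using that by blast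
  \<comment> \<open>In the threshold, \<open>3 ^ k\<close> compensates the size of the k-th
    correction, the factor 2 pays for the half of the hump that later corrections may destroy, and
    \<open>Suc k\<close> makes the rest unbounded.\<close>
  then have "\<exists>n. nrm (u n) > 2 * real (Suc k) * 3 ^ k" for k :: nat by (meson not_le)
  then obtain s where s: "\<And>k::nat. nrm (u (s k)) > 2 * real (Suc k) * 3 ^ k" by metis
  have spos: "nrm (u (s k)) > 0" for k using s[of k] by (smt (verit) mult_nonneg_nonneg of_nat_0_le_iff zero_le_power)
  have step: "\<exists>y. y \<in> V \<and> nrm (y - x) \<le> (1/3)^k \<and> (1/3)^k * nrm (u (s k)) \<le> \<bar>ip (u (s k)) y\<bar>"
    if x: "x \<in> V" for x k
  proof -
    define e where "e = ((1/3)^k / nrm (u (s k))) *\<^sub>R u (s k)"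
    have e: "e \<in> V" "nrm e = (1/3)^k" "ip (u (s k)) e = (1/3)^k * nrm (u (s k))"
      using u spos[of k] nrm_square[OF u, of "s k"]
      by (auto simp: e_def nrm_scale ip_simps power2_eq_square field_simps)
    \<comment> \<open>The products with \<open>x + e\<close> and \<open>x - e\<close> differ by
      twice \<open>ip (u (s k)) e\<close>, so they cannot both be smaller than it in absolute
      value.\<close>
    have "ip (u (s k)) e \<le> \<bar>ip (u (s k)) (x + e)\<bar> \<or> ip (u (s k)) e \<le> \<bar>ip (u (s k)) (x - e)\<bar>"
      using x e u by (simp add: ip_simps) linarith
    moreover have "nrm (x + e - x) \<le> (1/3)^k" "nrm (x - e - x) \<le> (1/3)^k"
      using e nrm_scale[of e "-1"] by auto
    ultimately show ?thesis using x e by (metis mem(2,3))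
  qed
  have "\<exists>x. \<forall>k. (x k \<in> V \<and> (1/3)^k * nrm (u (s k)) \<le> \<bar>ip (u (s k)) (x k)\<bar>) \<and> nrm (x (Suc k) - x k) \<le> (1/3)^(Suc k)"
    by (rule dependent_nat_choice) (use step[OF mem(1)] step in \<open>blast+\<close>)
  then obtain x where x: "\<And>k. x k \<in> V" and big: "\<And>k. (1/3)^k * nrm (u (s k)) \<le> \<bar>ip (u (s k)) (x k)\<bar>"
    and xd: "\<And>k. nrm (x (Suc k) - x k) \<le> (1/3)^(Suc k)" by blast
  \<comment> \<open>The right-hand side is the exact geometric sum of the corrections after step k.
    All of them together amount to at most half of the k-th bound, which is why the ratio is 1/3 and
    not 1/2.\<close>
  have dist: "nrm (x (k + j) - x k) \<le> (1/3)^k / 2 - (1/3)^(k + j) / 2" for k j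
  proof (induction j)
    case (Suc j)
    have "nrm (x (k + Suc j) - x k) \<le> nrm (x (Suc (k + j)) - x (k + j)) + nrm (x (k + j) - x k)"
      using nrm_triangle_diff[OF x x x] by simp
    then show ?case using Suc xd[of "k + j"] by simp
  qed simp
  then have dist': "nrm (x (k + j) - x k) \<le> (1/3)^k / 2" for k j
    by (smt (verit) zero_le_power divide_nonneg_nonneg)
  have "\<exists>v\<in>V. (\<lambda>n. nrm (x n - v)) \<longlonglongrightarrow> 0"
  proof (rule complete[OF x], intro allI impI)
    fix e :: real assume "0 < e"
    then obtain N where N: "(1/3)^N < e" using real_arch_pow_inv[of e "1/3"] by auto
    have "nrm (x i - x j) < e" if "i \<ge> N" "j \<ge> N" for i j
      using dist'[of N "i - N"] dist'[of N "j - N"] that N nrm_triangle_diff[of "x i" "x N" "x j"]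
        nrm_minus_commute[of "x N" "x j"] x by simp
    then show "\<exists>N. \<forall>i\<ge>N. \<forall>j\<ge>N. nrm (x i - x j) < e" by blast
  qed
  then obtain v where v: "v \<in> V" and lim: "(\<lambda>n. nrm (x n - v)) \<longlonglongrightarrow> 0" by blast
  have close: "nrm (x k - v) \<le> (1/3)^k / 2" for k
  proof -
    have "(\<lambda>j. (1/3)^k / 2 + nrm (x (j + k) - v)) \<longlonglongrightarrow> (1/3)^k / 2 + 0"
      by (intro tendsto_intros LIMSEQ_ignore_initial_segment lim)
    then have "nrm (x k - v) \<le> (1/3)^k / 2 + 0"
    proof (rule LIMSEQ_le_const, intro exI allI impI)
      fix j show "nrm (x k - v) \<le> (1/3)^k / 2 + nrm (x (j + k) - v)"
        using nrm_triangle_diff[OF x x v, of k "j + k"] dist'[of k j] nrm_minus_commute[OF x x, of k "j + k"]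
        by (simp add: add.commute)
    qed
    then show ?thesis by simp
  qed
  obtain B where B: "\<And>n. \<bar>ip (u n) v\<bar> \<le> B" using bdd[OF v] by (auto simp: Bseq_def)
  obtain k :: nat where k: "B < real k" using reals_Archimedean2 by blast
  have "\<bar>ip (u (s k)) (x k - v)\<bar> \<le> nrm (u (s k)) * ((1/3)^k / 2)"
    using Cauchy_Schwarz[of "u (s k)" "x k - v"] u x v close[of k]
    by (meson mem(3) mult_left_mono nrm_nonneg order_trans)
  then have "(1/3)^k * nrm (u (s k)) / 2 \<le> \<bar>ip (u (s k)) v\<bar>"
    using big[of k] u x v by (simp add: ip_simps mult.commute) (smt (verit))
  moreover have "real (Suc k) < (1/3)^k * nrm (u (s k)) / 2"
    using s[of k] by (simp add: power_one_over field_simps)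
  ultimately show False using B[of "s k"] k by simp
qed

end

section \<open>Completeness of \<open>L\<^sup>2\<close>\<close>

text \<open>The pointwise structure lets \<open>l2_space m\<close> and \<open>\<F>\<close> be
  subspaces of a \<open>real_vector\<close> type; \<open>fun_space_defs\<close> below translates to
  the explicit abstractions of the definitions.\<close>

instantiation "fun" :: (type, real_vector) real_vector
begin

definition scaleR_fun :: "real \<Rightarrow> ('a \<Rightarrow> 'b) \<Rightarrow> 'a \<Rightarrow> 'b" where
  "scaleR_fun c f = (\<lambda>x. c *\<^sub>R f x)"

instance
  by standard (simp_all add: scaleR_fun_def fun_eq_iff scaleR_add_right scaleR_add_left)

end

lemmas fun_space_defs = plus_fun_def fun_diff_def scaleR_fun_def zero_fun_def

lemma l2_space_measurable: "f \<in> l2_space m \<Longrightarrow> f \<in> borel_measurable m"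
  by (simp add: l2_space_def)

lemma l2_space_integrable_mult:
  assumes "f \<in> l2_space m" "g \<in> l2_space m"
  shows "integrable m (\<lambda>x. f x * g x)"
proof (rule Bochner_Integration.integrable_bound)
  show "integrable m (\<lambda>x. (f x)\<^sup>2 + (g x)\<^sup>2)"
    using assms by (auto simp: l2_space_def)
  show "(\<lambda>x. f x * g x) \<in> borel_measurable m"
    using assms by (auto simp: l2_space_def)
  have "\<bar>a * b\<bar> \<le> a\<^sup>2 + b\<^sup>2" for a b :: real
  proof -
    have "0 \<le> \<bar>a\<bar> * \<bar>b\<bar>" by simp
    then show ?thesis
      using sum_squares_bound[of "\<bar>a\<bar>" "\<bar>b\<bar>"] by (simp only: abs_mult power2_abs mult.assoc)
  qed
  then show "AE x in m. norm (f x * g x) \<le> norm ((f x)\<^sup>2 + (g x)\<^sup>2)"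
    by auto
qed

lemma subspace_l2_space: "subspace (l2_space m)"
proof (rule subspaceI)
  show "0 \<in> l2_space m" by (simp add: l2_space_def zero_fun_def)
  show "f + g \<in> l2_space m" if "f \<in> l2_space m" "g \<in> l2_space m" for f g
    using that l2_space_integrable_mult[OF that]
    by (auto simp: l2_space_def plus_fun_def power2_sum mult.assoc)
  show "c *\<^sub>R f \<in> l2_space m" if "f \<in> l2_space m" for c f
    using that by (auto simp: l2_space_def scaleR_fun_def power_mult_distrib)
qed

interpretation l2: semi_inner_space "l2_space m" "l2_inner m"
  rewrites nrm_l2: "semi_inner_space.nrm (l2_inner m) = l2_norm m"
proof -
  show "semi_inner_space (l2_space m) (l2_inner m)"
  proof
    show "l2_inner m f g = l2_inner m g f" for f g by (simp add: l2_inner_def mult.commute)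
    show "l2_inner m (f + g) h = l2_inner m f h + l2_inner m g h"
      if "f \<in> l2_space m" "g \<in> l2_space m" "h \<in> l2_space m" for f g h
      using that by (simp add: l2_inner_def fun_space_defs ring_distribs l2_space_integrable_mult)
  qed (simp_all add: subspace_l2_space l2_inner_def fun_space_defs mult.assoc)
  then interpret semi_inner_space "l2_space m" "l2_inner m" .
  show "semi_inner_space.nrm (l2_inner m) = l2_norm m"
    by (simp add: fun_eq_iff nrm_def l2_norm_def)
qed

lemma l2_norm_eq_0_iff:
  assumes "f \<in> l2_space m"
  shows "l2_norm m f = 0 \<longleftrightarrow> (AE x in m. f x = 0)"
  using integral_nonneg_eq_0_iff_AE[of m "\<lambda>x. f x * f x"] l2_space_integrable_mult[OF assms assms]
  by (simp add: l2_norm_def l2_inner_def)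

lemma l2_norm_diff_eq_0_iff:
  assumes "f \<in> l2_space m" "g \<in> l2_space m"
  shows "l2_norm m (f - g) = 0 \<longleftrightarrow> (AE x in m. f x = g x)"
  using l2_norm_eq_0_iff[OF l2.mem(3)[OF assms]] by (simp add: fun_diff_def)

lemma nn_integral_l2_square:
  assumes "f \<in> l2_space m"
  shows "(\<integral>\<^sup>+x. ennreal ((f x)\<^sup>2) \<partial>m) = ennreal ((l2_norm m f)\<^sup>2)"
  using assms nn_integral_eq_integral[of m "\<lambda>x. (f x)\<^sup>2"]
  by (simp add: l2_space_def l2.nrm_square) (simp add: l2_inner_def power2_eq_square)

text \<open>The way back from nonnegative integrals, where Fatou applies before integrability is
  known, to \<open>l2_space\<close> and its norm.\<close>

lemma l2_space_nn_integralI: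
  assumes "f \<in> borel_measurable m" and "(\<integral>\<^sup>+x. ennreal ((f x)\<^sup>2) \<partial>m) \<le> ennreal (e\<^sup>2)" and "0 \<le> e"
  shows "f \<in> l2_space m" and "l2_norm m f \<le> e"
proof -
  show f: "f \<in> l2_space m"
    using assms(1) le_less_trans[OF assms(2) ennreal_less_top]
    by (auto simp: l2_space_def intro!: integrableI_nonneg)
  show "l2_norm m f \<le> e"
  proof (rule power2_le_imp_le[OF _ assms(3)])
    have "ennreal ((l2_norm m f)\<^sup>2) \<le> ennreal (e\<^sup>2)"
      using assms(2) unfolding nn_integral_l2_square[OF f] .
    then show "(l2_norm m f)\<^sup>2 \<le> e\<^sup>2" by (subst (asm) ennreal_le_iff) auto
  qed
qed

text \<open>Boundedness of the summands already makes the k-th step at most a constant times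
  \<open>(1 / sqrt 2) ^ k\<close>, so the steps are absolutely summable. The geometric weights are
  what turns square summability into summability.\<close>

lemma convergent_of_square_steps:
  fixes a :: "nat \<Rightarrow> real"
  assumes "(\<Sum>k. ennreal (2 ^ k * (a (Suc k) - a k)\<^sup>2)) \<noteq> \<infinity>"
  shows "convergent a"
proof -
  have "summable (\<lambda>k. 2 ^ k * (a (Suc k) - a k)\<^sup>2)"
    using assms by (intro summable_suminf_not_top) auto
  then have "Bseq (\<lambda>k. 2 ^ k * (a (Suc k) - a k)\<^sup>2)"
    by (rule convergent_imp_Bseq[OF convergentI[OF summable_LIMSEQ_zero]])
  then obtain B where B: "0 < B" "\<And>k. 2 ^ k * (a (Suc k) - a k)\<^sup>2 \<le> B"
    by (auto simp: Bseq_def abs_mult)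
  have "norm (a (Suc k) - a k) \<le> sqrt B * (1 / sqrt 2) ^ k" for k
  proof -
    have "(a (Suc k) - a k)\<^sup>2 \<le> B / 2 ^ k" using B(2)[of k] by (simp add: field_simps)
    then have "\<bar>a (Suc k) - a k\<bar> \<le> sqrt (B / 2 ^ k)" using real_sqrt_le_mono by fastforce
    then show ?thesis by (simp add: real_sqrt_divide real_sqrt_power power_one_over)
  qed
  moreover have "summable (\<lambda>k. sqrt B * (1 / sqrt 2) ^ k)"
    by (rule summable_mult[OF summable_geometric]) simp
  ultimately have "summable (\<lambda>k. a (Suc k) - a k)"
    by (rule summable_comparison_test'[rotated])
  then have "convergent (\<lambda>n. \<Sum>k<n. a (Suc k) - a k)" by (simp add: summable_iff_convergent)
  then have "convergent (\<lambda>n. a n - a 0)" by (simp add: sum_lessThan_telescope)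
  then show ?thesis using convergent_add_const_right_iff[of a "- a 0"] by simp
qed

text \<open>Riesz-Fischer: a fast subsequence converges almost everywhere, and Fatou along it bounds
  the distance of the whole sequence from the pointwise limit.\<close>

theorem l2_complete:
  assumes u: "\<And>n::nat. u n \<in> l2_space m"
    and cauchy: "\<forall>e>0. \<exists>N. \<forall>i\<ge>N. \<forall>j\<ge>N. l2_norm m (u i - u j) < e"
  shows "\<exists>v\<in>l2_space m. (\<lambda>n. l2_norm m (u n - v)) \<longlonglongrightarrow> 0"
proof -
  note [measurable] = l2_space_measurable[OF u]
  \<comment> \<open>At this rate the squared steps are at most \<open>(1/4) ^ k\<close>, so that
    weights \<open>2 ^ k\<close> still leave the summable \<open>(1/2) ^ k\<close>.\<close>
  have "\<exists>N. \<forall>i\<ge>N. \<forall>j\<ge>N. l2_norm m (u i - u j) < (1/2) ^ k" for k :: nat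
    using cauchy by simp
  then obtain s where s: "\<And>k i j. i \<ge> s k \<Longrightarrow> j \<ge> s k \<Longrightarrow> l2_norm m (u i - u j) < (1/2) ^ k"
    by metis
  \<comment> \<open>Adding \<open>k\<close> and all earlier thresholds makes \<open>r\<close>
    increasing and at least both \<open>s k\<close> and \<open>k\<close>.\<close>
  define r where "r k = k + (\<Sum>i\<le>k. s i)" for k
  have r_s: "s k \<le> r k" "r k \<le> r (Suc k)" "k \<le> r k" for k
    by (auto simp: r_def intro: order_trans[OF member_le_sum[of k "{..k}" s]])
  have "(\<integral>\<^sup>+x. ennreal (2 ^ k * (u (r (Suc k)) x - u (r k) x)\<^sup>2) \<partial>m) \<le> ennreal ((1/2) ^ k)" for k
  proof -
    have "(\<integral>\<^sup>+x. ennreal (2 ^ k * (u (r (Suc k)) x - u (r k) x)\<^sup>2) \<partial>m)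
        = 2 ^ k * ennreal ((l2_norm m (u (r (Suc k)) - u (r k)))\<^sup>2)"
      using nn_integral_l2_square[OF l2.mem(3)[OF u u], of "r (Suc k)" "r k"]
      by (simp add: ennreal_mult nn_integral_cmult fun_diff_def flip: ennreal_power)
    also have "\<dots> \<le> 2 ^ k * ennreal (((1/2) ^ k)\<^sup>2)"
      using s[of k "r (Suc k)" "r k"] r_s[of k]
      by (intro mult_left_mono ennreal_leI power_mono) (auto intro: less_imp_le simp: u)
    also have "\<dots> = ennreal (2 ^ k * ((1/2) ^ k)\<^sup>2)"
      by (simp add: ennreal_mult flip: ennreal_power)
    also have "2 ^ k * ((1/2) ^ k)\<^sup>2 = (1/2 :: real) ^ k"
      by (simp add: power2_eq_square power_one_over)
    finally show ?thesis .
  qed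
  then have "(\<Sum>k. \<integral>\<^sup>+x. ennreal (2 ^ k * (u (r (Suc k)) x - u (r k) x)\<^sup>2) \<partial>m) \<le> (\<Sum>k. ennreal ((1/2) ^ k))"
    by (intro suminf_le) auto
  also have "\<dots> = ennreal (\<Sum>k. (1/2) ^ k)" by (intro suminf_ennreal2) auto
  finally have "(\<integral>\<^sup>+x. (\<Sum>k. ennreal (2 ^ k * (u (r (Suc k)) x - u (r k) x)\<^sup>2)) \<partial>m) \<noteq> \<infinity>"
    by (subst nn_integral_suminf) (auto simp: top_unique)
  then have "AE x in m. (\<Sum>k. ennreal (2 ^ k * (u (r (Suc k)) x - u (r k) x)\<^sup>2)) \<noteq> \<infinity>"
    by (intro nn_integral_PInf_AE) auto
  then have conv: "AE x in m. convergent (\<lambda>k. u (r k) x)"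
    by eventually_elim (rule convergent_of_square_steps)
  \<comment> \<open>Off a null set this is the limit of the subsequence; elsewhere the unspecified
    value of \<open>lim\<close> is harmless and \<open>v\<close> stays measurable.\<close>
  define v where "v x = lim (\<lambda>k. u (r k) x)" for x
  have [measurable]: "v \<in> borel_measurable m"
    unfolding v_def by measurable
  have fatou: "(\<integral>\<^sup>+x. ennreal ((u i x - v x)\<^sup>2) \<partial>m) \<le> ennreal (((1/2) ^ k)\<^sup>2)" if "i \<ge> s k" for i k
  proof -
    have "(\<integral>\<^sup>+x. ennreal ((u i x - v x)\<^sup>2) \<partial>m) = (\<integral>\<^sup>+x. liminf (\<lambda>j. ennreal ((u i x - u (r j) x)\<^sup>2)) \<partial>m)"
    proof (rule nn_integral_cong_AE)
      show "AE x in m. ennreal ((u i x - v x)\<^sup>2) = liminf (\<lambda>j. ennreal ((u i x - u (r j) x)\<^sup>2))"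
        using conv
      proof eventually_elim
        case (elim x)
        then have "(\<lambda>j. ennreal ((u i x - u (r j) x)\<^sup>2)) \<longlonglongrightarrow> ennreal ((u i x - v x)\<^sup>2)"
          by (intro tendsto_ennrealI tendsto_intros) (simp add: v_def convergent_LIMSEQ_iff)
        then show ?case by (rule lim_imp_Liminf[symmetric, rotated]) simp
      qed
    qed
    also have "\<dots> \<le> liminf (\<lambda>j. \<integral>\<^sup>+x. ennreal ((u i x - u (r j) x)\<^sup>2) \<partial>m)"
      by (rule nn_integral_liminf) auto
    also have "\<dots> \<le> ennreal (((1/2) ^ k)\<^sup>2)"
    proof -
      have "(\<integral>\<^sup>+x. ennreal ((u i x - u (r j) x)\<^sup>2) \<partial>m) \<le> ennreal (((1/2) ^ k)\<^sup>2)" if "j \<ge> s k" for j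
        using nn_integral_l2_square[OF l2.mem(3)[OF u u], of i "r j"] s[OF \<open>i \<ge> s k\<close>, of "r j"] r_s(3)[of j] that
        by (simp add: fun_diff_def) (intro ennreal_leI power_mono, auto simp: l2_norm_def l2_inner_def fun_diff_def intro: less_imp_le)
      then have "\<forall>\<^sub>F j in sequentially. (\<integral>\<^sup>+x. ennreal ((u i x - u (r j) x)\<^sup>2) \<partial>m) \<le> ennreal (((1/2) ^ k)\<^sup>2)"
        by (auto simp: eventually_sequentially)
      then show ?thesis
        by (intro Liminf_le) auto
    qed
    finally show ?thesis .
  qed
  have diff: "u i - v \<in> l2_space m" "l2_norm m (u i - v) \<le> (1/2) ^ k" if "i \<ge> s k" for i k
    using l2_space_nn_integralI[of "u i - v" m "(1/2) ^ k"] fatou[OF that] by (auto simp: fun_diff_def)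
  \<comment> \<open>Fatou shows only that differences \<open>u i - v\<close> are square integrable;
    \<open>v\<close> itself is recovered from one of them.\<close>
  have "u (s 0) - (u (s 0) - v) \<in> l2_space m" by (rule l2.mem(3)[OF u diff(1)[OF order_refl]])
  then have "v \<in> l2_space m" by simp
  moreover have "(\<lambda>n. l2_norm m (u n - v)) \<longlonglongrightarrow> 0"
  proof (rule LIMSEQ_I)
    fix e :: real assume "0 < e"
    then obtain k where "(1/2) ^ k < e" using real_arch_pow_inv[of e "1/2"] by auto
    then have "\<forall>n\<ge>s k. norm (l2_norm m (u n - v) - 0) < e"
      using diff[of k] \<open>v \<in> l2_space m\<close> u by (auto intro: le_less_trans)
    then show "\<exists>N. \<forall>n\<ge>N. norm (l2_norm m (u n - v) - 0) < e" by blast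
  qed
  ultimately show ?thesis by blast
qed

interpretation l2: semi_hilbert "l2_space m" "l2_inner m"
  rewrites "semi_inner_space.nrm (l2_inner m) = l2_norm m"
  by unfold_locales (auto simp: nrm_l2 intro: l2_complete)

section \<open>Closed forms and their resolvents\<close>

lemma l2_inner_cong_AE:
  assumes "f \<in> l2_space m" "f' \<in> l2_space m" "g \<in> l2_space m" "AE x in m. f x = f' x"
  shows "l2_inner m f g = l2_inner m f' g"
  by (rule l2.ip_cong_left) (use assms in \<open>simp_all add: l2_norm_diff_eq_0_iff\<close>)

lemma l2_norm_diff_less: "x \<in> l2_space m \<Longrightarrow> y \<in> l2_space m \<Longrightarrow> z \<in> l2_space m \<Longrightarrow>
    l2_norm m (x - y) < a \<Longrightarrow> l2_norm m (y - z) < b \<Longrightarrow> l2_norm m (x - z) < a + b"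
  using l2.nrm_triangle_diff[of x m y z] by linarith

section \<open>Closures of subspaces and the projections onto them\<close>

lemma l2_closure_altdef: "l2_closure m S = {f \<in> l2_space m. \<forall>e>0. \<exists>g\<in>S. l2_norm m (f - g) < e}"
  by (simp add: l2_closure_def fun_diff_def)

lemma l2_closure_subset: "l2_closure m S \<subseteq> l2_space m"
  by (auto simp: l2_closure_def)

lemma subset_l2_closure: "S \<subseteq> l2_space m \<Longrightarrow> S \<subseteq> l2_closure m S"
proof
  fix f assume "S \<subseteq> l2_space m" "f \<in> S"
  moreover have "l2_norm m (f - f) < e" if "0 < e" for e
    using that l2.nrm_zero by simp
  ultimately show "f \<in> l2_closure m S" unfolding l2_closure_altdef by blast
qed

lemma subspace_l2_closure:
  assumes S: "subspace S" "S \<subseteq> l2_space m"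
  shows "subspace (l2_closure m S)"
proof (rule subspaceI)
  show "0 \<in> l2_closure m S"
    using subset_l2_closure[OF S(2)] subspace_0[OF S(1)] by blast
  show "f + g \<in> l2_closure m S" if fg: "f \<in> l2_closure m S" "g \<in> l2_closure m S" for f g
    unfolding l2_closure_altdef
  proof (intro CollectI conjI allI impI)
    show "f + g \<in> l2_space m" using fg l2_closure_subset by blast
    fix e :: real assume e: "0 < e"
    obtain f' g' where *: "f' \<in> S" "g' \<in> S" "l2_norm m (f - f') < e / 2" "l2_norm m (g - g') < e / 2"
      using fg half_gt_zero[OF e] unfolding l2_closure_altdef by blast
    have "f - f' \<in> l2_space m" "g - g' \<in> l2_space m" using fg * S(2) l2_closure_subset by blast+
    then have "l2_norm m ((f - f') + (g - g')) < e"
      using le_less_trans[OF l2.nrm_triangle add_strict_mono[OF *(3,4)]] by simp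
    then have "l2_norm m (f + g - (f' + g')) < e" by (simp add: algebra_simps)
    then show "\<exists>h\<in>S. l2_norm m (f + g - h) < e"
      using subspace_add[OF S(1) *(1,2)] by blast
  qed
  show "c *\<^sub>R f \<in> l2_closure m S" if f: "f \<in> l2_closure m S" for c f
    unfolding l2_closure_altdef
  proof (intro CollectI conjI allI impI)
    show "c *\<^sub>R f \<in> l2_space m" using f l2_closure_subset by blast
    fix e :: real assume e: "0 < e"
    then have "0 < e / (\<bar>c\<bar> + 1)" by simp
    then obtain g where g: "g \<in> S" "l2_norm m (f - g) < e / (\<bar>c\<bar> + 1)"
      using f unfolding l2_closure_altdef by blast
    have fg: "f - g \<in> l2_space m" using f g S(2) l2_closure_subset by blast
    have "l2_norm m (c *\<^sub>R (f - g)) = \<bar>c\<bar> * l2_norm m (f - g)" using l2.nrm_scale[OF fg] .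
    also have "\<dots> \<le> (\<bar>c\<bar> + 1) * l2_norm m (f - g)" using l2.nrm_nonneg[OF fg] by (simp add: algebra_simps)
    also have "\<dots> < e" using g(2) by (simp add: field_simps)
    finally show "\<exists>h\<in>S. l2_norm m (c *\<^sub>R f - h) < e"
      using subspace_scale[OF S(1) g(1), of c] by (auto simp: scaleR_diff_right)
  qed
qed

lemma l2_closure_closed:
  assumes S: "S \<subseteq> l2_space m" and u: "\<And>n::nat. u n \<in> l2_closure m S" and v: "v \<in> l2_space m"
    and lim: "(\<lambda>n. l2_norm m (u n - v)) \<longlonglongrightarrow> 0"
  shows "v \<in> l2_closure m S"
  unfolding l2_closure_altdef
proof (intro CollectI conjI allI impI v)
  fix e :: real assume "0 < e"
  then have e: "0 < e / 2" by simp
  obtain n where n: "l2_norm m (u n - v) < e / 2"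
    using order_tendstoD(2)[OF lim e] by (auto dest: eventually_happens)
  obtain g where g: "g \<in> S" "l2_norm m (u n - g) < e / 2"
    using u[of n] e unfolding l2_closure_altdef by blast
  have un: "u n \<in> l2_space m" using u l2_closure_subset by blast
  have "l2_norm m (v - g) < e"
    using l2_norm_diff_less[of v m "u n" g "e / 2" "e / 2"] l2.nrm_minus_commute[OF un v] n g un v S by auto
  then show "\<exists>g\<in>S. l2_norm m (v - g) < e" using g by blast
qed

text \<open>The closure is a closed subspace, so the projection theorem supplies a candidate and the
  \<open>SOME\<close> in \<open>l2_proj\<close> satisfies its own condition.\<close>

lemma l2_proj:
  assumes S: "subspace S" "S \<subseteq> l2_space m" and f: "f \<in> l2_space m"
  shows "l2_proj m (l2_closure m S) f \<in> l2_closure m S"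
    and "\<And>w. w \<in> l2_closure m S \<Longrightarrow> l2_inner m (f - l2_proj m (l2_closure m S) f) w = 0"
proof -
  have "\<exists>p\<in>l2_closure m S. \<forall>w\<in>l2_closure m S. l2_inner m (f - p) w = 0"
    by (rule l2.projection[OF subspace_l2_closure[OF S] l2_closure_subset l2_closure_closed[OF S(2)] f])
  then have "\<exists>p. p \<in> l2_closure m S \<and> (\<forall>w\<in>l2_closure m S. l2_inner m (f - p) w = 0)" by blast
  from someI_ex[OF this]
  show "l2_proj m (l2_closure m S) f \<in> l2_closure m S"
    and "\<And>w. w \<in> l2_closure m S \<Longrightarrow> l2_inner m (f - l2_proj m (l2_closure m S) f) w = 0"
    by (simp_all add: l2_proj_def fun_diff_def)
qed

section \<open>Completeness for every shift, resolvents and lower semicontinuity of the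
  energy\<close>

locale closed_form =
  fixes m :: "'a measure" and \<E> \<F>
  assumes closed_symmetric_form: "closed_symmetric_form m \<E> \<F>"
begin

text \<open>The conjuncts of the definition, with the explicit abstractions replaced by the vector
  space operations on functions, as the semi-inner product locale requires.\<close>

lemma closed_symmetric_formD:
  shows domain_l2: "\<F> \<subseteq> l2_space m"
    and "\<forall>f\<in>\<F>. \<forall>g\<in>l2_space m. (AE x in m. f x = g x) \<longrightarrow> g \<in> \<F>"
    and "0 \<in> \<F>"
    and "\<forall>f\<in>\<F>. \<forall>g\<in>\<F>. f + g \<in> \<F>"
    and "\<forall>f\<in>\<F>. \<forall>c. c *\<^sub>R f \<in> \<F>"
    and "\<forall>f\<in>\<F>. \<forall>f'\<in>\<F>. \<forall>g\<in>\<F>. (AE x in m. f x = f' x) \<longrightarrow> \<E> f g = \<E> f' g"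
    and "\<forall>f\<in>\<F>. \<forall>g\<in>\<F>. \<E> f g = \<E> g f"
    and "\<forall>f\<in>\<F>. \<forall>f'\<in>\<F>. \<forall>g\<in>\<F>. \<E> (f + f') g = \<E> f g + \<E> f' g"
    and "\<forall>f\<in>\<F>. \<forall>g\<in>\<F>. \<forall>c. \<E> (c *\<^sub>R f) g = c * \<E> f g"
    and "\<forall>f\<in>\<F>. 0 \<le> \<E> f f"
    and "\<forall>u. (\<forall>n::nat. u n \<in> \<F>) \<and>
      (\<forall>e>0. \<exists>N. \<forall>i\<ge>N. \<forall>j\<ge>N. sqrt (form_alpha m \<E> 1 (u i - u j) (u i - u j)) < e) \<longrightarrow>
      (\<exists>v\<in>\<F>. (\<lambda>n. sqrt (form_alpha m \<E> 1 (u n - v) (u n - v))) \<longlonglongrightarrow> 0)"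
proof -
  note c0 = closed_symmetric_form[unfolded closed_symmetric_form_def]
  note c1 = conjunct2[OF c0]
  note c2 = conjunct2[OF c1]
  note c3 = conjunct2[OF c2]
  note c4 = conjunct2[OF c3]
  note c5 = conjunct2[OF c4]
  note c6 = conjunct2[OF c5]
  note c7 = conjunct2[OF c6]
  note c8 = conjunct2[OF c7]
  note c9 = conjunct2[OF c8]
  note c10 = conjunct2[OF c9]
  note c = conjunct1[OF c0] conjunct1[OF c1] conjunct1[OF c2] conjunct1[OF c3] conjunct1[OF c4] conjunct1[OF c5] conjunct1[OF c6] conjunct1[OF c7] conjunct1[OF c8] conjunct1[OF c9] c10
  show "\<F> \<subseteq> l2_space m"
    and "\<forall>f\<in>\<F>. \<forall>g\<in>l2_space m. (AE x in m. f x = g x) \<longrightarrow> g \<in> \<F>"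
    and "0 \<in> \<F>"
    and "\<forall>f\<in>\<F>. \<forall>g\<in>\<F>. f + g \<in> \<F>"
    and "\<forall>f\<in>\<F>. \<forall>c. c *\<^sub>R f \<in> \<F>"
    and "\<forall>f\<in>\<F>. \<forall>f'\<in>\<F>. \<forall>g\<in>\<F>. (AE x in m. f x = f' x) \<longrightarrow> \<E> f g = \<E> f' g"
    and "\<forall>f\<in>\<F>. \<forall>g\<in>\<F>. \<E> f g = \<E> g f"
    and "\<forall>f\<in>\<F>. \<forall>f'\<in>\<F>. \<forall>g\<in>\<F>. \<E> (f + f') g = \<E> f g + \<E> f' g"
    and "\<forall>f\<in>\<F>. \<forall>g\<in>\<F>. \<forall>c. \<E> (c *\<^sub>R f) g = c * \<E> f g"
    and "\<forall>f\<in>\<F>. 0 \<le> \<E> f f"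
    and "\<forall>u. (\<forall>n::nat. u n \<in> \<F>) \<and> (\<forall>e>0. \<exists>N. \<forall>i\<ge>N. \<forall>j\<ge>N. sqrt (form_alpha m \<E> 1 (u i - u j) (u i - u j)) < e) \<longrightarrow> (\<exists>v\<in>\<F>. (\<lambda>n. sqrt (form_alpha m \<E> 1 (u n - v) (u n - v))) \<longlonglongrightarrow> 0)"
    unfolding fun_space_defs real_scaleR_def by (rule c)+
qed

lemma domain_l2' [simp, intro]: "f \<in> \<F> \<Longrightarrow> f \<in> l2_space m"
  using domain_l2 by (rule subsetD)

lemma domain_AE: "f \<in> \<F> \<Longrightarrow> g \<in> l2_space m \<Longrightarrow> (AE x in m. f x = g x) \<Longrightarrow> g \<in> \<F>"
  using closed_symmetric_formD(2) by blast

lemma form_AE: "f \<in> \<F> \<Longrightarrow> f' \<in> \<F> \<Longrightarrow> g \<in> \<F> \<Longrightarrow> (AE x in m. f x = f' x) \<Longrightarrow> \<E> f g = \<E> f' g"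
  using closed_symmetric_formD(6) by blast

sublocale form: semi_inner_space \<F> \<E>
proof
  show "subspace \<F>"
    using closed_symmetric_formD(3-5) by (simp add: subspace_def)
  show "\<E> x y = \<E> y x" if "x \<in> \<F>" "y \<in> \<F>" for x y
    using closed_symmetric_formD(7) that by blast
qed (use closed_symmetric_formD(8-10) in simp_all)

lemma alpha_inner:
  assumes "0 < \<alpha>"
  shows "semi_inner_space \<F> (form_alpha m \<E> \<alpha>)"
proof
  show "form_alpha m \<E> \<alpha> x y = form_alpha m \<E> \<alpha> y x" if "x \<in> \<F>" "y \<in> \<F>" for x y
    using form.ip_commute[OF that] l2.ip_commute[of x m y] that by (simp add: form_alpha_def)
  show "0 \<le> form_alpha m \<E> \<alpha> x x" if "x \<in> \<F>" for x
    using form.ip_nonneg[OF that] l2.ip_nonneg[of x m] that assms by (simp add: form_alpha_def)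
qed (simp_all add: form.subspace form_alpha_def form.ip_simps l2.ip_simps algebra_simps)

lemma alpha_hilbert:
  assumes \<alpha>: "0 < \<alpha>"
  shows "semi_hilbert \<F> (form_alpha m \<E> \<alpha>)"
proof -
  interpret A: semi_inner_space \<F> "form_alpha m \<E> \<alpha>" by (rule alpha_inner[OF \<alpha>])
  interpret B: semi_inner_space \<F> "form_alpha m \<E> 1" by (rule alpha_inner) simp
  \<comment> \<open>Completeness is given for shift 1 only. \<open>K\<close> and \<open>L\<close>
    are the constants of equivalence: the form with shift 1 is at most \<open>K\<close> times the
    one with shift \<alpha>, which is at most \<open>L\<close> times the one with shift 1.\<close>
  define K where "K = max 1 (1 / \<alpha>)"
  define L where "L = max 1 \<alpha>"
  have K: "1 \<le> K" "1 \<le> K * \<alpha>" and L: "1 \<le> L" "\<alpha> \<le> L"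
    using \<alpha> by (auto simp: K_def L_def field_simps max_def)
  have BA: "B.nrm f \<le> sqrt K * A.nrm f" if "f \<in> \<F>" for f
  proof -
    have "\<E> f f + l2_inner m f f \<le> K * \<E> f f + (K * \<alpha>) * l2_inner m f f"
      using mult_right_mono[OF K(1) form.ip_nonneg[OF that]] mult_right_mono[OF K(2) l2.ip_nonneg[of f m]] that by simp
    then have "form_alpha m \<E> 1 f f \<le> K * form_alpha m \<E> \<alpha> f f"
      by (simp add: form_alpha_def algebra_simps)
    then show ?thesis unfolding A.nrm_def B.nrm_def by (metis real_sqrt_le_mono real_sqrt_mult)
  qed
  have AB: "A.nrm f \<le> sqrt L * B.nrm f" if "f \<in> \<F>" for f
  proof -
    have "\<E> f f + \<alpha> * l2_inner m f f \<le> L * \<E> f f + L * l2_inner m f f"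
      using mult_right_mono[OF L(1) form.ip_nonneg[OF that]] mult_right_mono[OF L(2) l2.ip_nonneg[of f m]] that by simp
    then have "form_alpha m \<E> \<alpha> f f \<le> L * form_alpha m \<E> 1 f f"
      by (simp add: form_alpha_def algebra_simps)
    then show ?thesis unfolding A.nrm_def B.nrm_def by (metis real_sqrt_le_mono real_sqrt_mult)
  qed
  show ?thesis
  proof
    fix u assume u: "\<And>n::nat. u n \<in> \<F>" and c: "\<forall>e>0. \<exists>N. \<forall>i\<ge>N. \<forall>j\<ge>N. A.nrm (u i - u j) < e"
    have "\<forall>e>0. \<exists>N. \<forall>i\<ge>N. \<forall>j\<ge>N. B.nrm (u i - u j) < e"
    proof (intro allI impI)
      fix e :: real assume e: "0 < e"
      then have "0 < e / sqrt K" using K by simp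
      then obtain N where N: "\<And>i j. i \<ge> N \<Longrightarrow> j \<ge> N \<Longrightarrow> A.nrm (u i - u j) < e / sqrt K"
        using c by meson
      have "B.nrm (u i - u j) < e" if "i \<ge> N" "j \<ge> N" for i j
      proof -
        have "sqrt K * A.nrm (u i - u j) < e"
          using N[OF that] K by (simp add: field_simps)
        then show ?thesis using BA[of "u i - u j"] u by fastforce
      qed
      then show "\<exists>N. \<forall>i\<ge>N. \<forall>j\<ge>N. B.nrm (u i - u j) < e" by blast
    qed
    then obtain v where v: "v \<in> \<F>" "(\<lambda>n. B.nrm (u n - v)) \<longlonglongrightarrow> 0"
      using closed_symmetric_formD(11)[rule_format, of u] u unfolding B.nrm_def by blast
    have "(\<lambda>n. A.nrm (u n - v)) \<longlonglongrightarrow> 0"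
      by (rule tendsto_0_le[OF v(2), of _ "sqrt L"])
        (use AB u v(1) in \<open>auto simp: mult.commute intro!: always_eventually\<close>)
    then show "\<exists>v\<in>\<F>. (\<lambda>n. A.nrm (u n - v)) \<longlonglongrightarrow> 0" using v(1) by blast
  qed
qed

lemma l2_norm_le_alpha:
  assumes "0 < \<alpha>" "g \<in> \<F>"
  shows "l2_norm m g \<le> 1 / sqrt \<alpha> * semi_inner_space.nrm (form_alpha m \<E> \<alpha>) g"
proof -
  interpret semi_inner_space \<F> "form_alpha m \<E> \<alpha>" by (rule alpha_inner[OF assms(1)])
  have "\<alpha> * l2_inner m g g \<le> form_alpha m \<E> \<alpha> g g"
    using form.ip_nonneg[OF assms(2)] by (simp add: form_alpha_def)
  then have "sqrt \<alpha> * l2_norm m g \<le> nrm g"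
    unfolding nrm_def l2_norm_def by (metis real_sqrt_le_mono real_sqrt_mult)
  then show ?thesis using assms(1) by (simp add: field_simps)
qed

abbreviation resolvent :: "real \<Rightarrow> ('a \<Rightarrow> real) \<Rightarrow> 'a \<Rightarrow> real" where
  "resolvent \<equiv> form_resolvent m \<E> \<F>"

text \<open>Pairing with f is bounded for the norm with shift \<alpha>, because that norm dominates
  \<open>sqrt \<alpha>\<close> times the L2 norm; the Riesz vector is a witness for the
  \<open>SOME\<close>. Here f is any element of \<open>l2_space m\<close>, as only its products with
  \<open>\<F>\<close> enter.\<close>

lemma resolvent:
  assumes \<alpha>: "0 < \<alpha>" and f: "f \<in> l2_space m"
  shows resolvent_domain: "resolvent \<alpha> f \<in> \<F>"
    and resolvent_eq: "\<And>g. g \<in> \<F> \<Longrightarrow> form_alpha m \<E> \<alpha> (resolvent \<alpha> f) g = l2_inner m f g"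
proof -
  interpret semi_hilbert \<F> "form_alpha m \<E> \<alpha>" by (rule alpha_hilbert[OF \<alpha>])
  have "\<exists>u\<in>\<F>. \<forall>g\<in>\<F>. form_alpha m \<E> \<alpha> u g = l2_inner m f g"
  proof (rule riesz_representation[of _ "l2_norm m f * (1 / sqrt \<alpha>)"])
    show "\<bar>l2_inner m f g\<bar> \<le> l2_norm m f * (1 / sqrt \<alpha>) * nrm g" if "g \<in> \<F>" for g
      using l2.Cauchy_Schwarz[OF f domain_l2'[OF that]] mult_left_mono[OF l2_norm_le_alpha[OF \<alpha> that] l2.nrm_nonneg[OF f]]
      by (simp add: mult.assoc)
  qed (use f in \<open>simp_all add: l2.ip_simps\<close>)
  then have "\<exists>u. u \<in> \<F> \<and> (\<forall>g\<in>\<F>. form_alpha m \<E> \<alpha> u g = l2_inner m f g)" by blast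
  from someI_ex[OF this]
  show "resolvent \<alpha> f \<in> \<F>"
    and "\<And>g. g \<in> \<F> \<Longrightarrow> form_alpha m \<E> \<alpha> (resolvent \<alpha> f) g = l2_inner m f g"
    by (simp_all add: form_resolvent_def)
qed

text \<open>Expand the nonnegative square of \<open>v - resolvent \<alpha> f\<close> for the form
  with shift \<alpha> and use the resolvent equation in the cross term.\<close>

lemma resolvent_variational:
  assumes \<alpha>: "0 < \<alpha>" and f: "f \<in> l2_space m" and v: "v \<in> \<F>"
  shows "2 * l2_inner m f v - form_alpha m \<E> \<alpha> v v \<le> l2_inner m f (resolvent \<alpha> f)"
proof -
  interpret semi_inner_space \<F> "form_alpha m \<E> \<alpha>" by (rule alpha_inner[OF \<alpha>])
  have u: "resolvent \<alpha> f \<in> \<F>" by (rule resolvent_domain[OF \<alpha> f])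
  show ?thesis
    using ip_nonneg[of "v - resolvent \<alpha> f"] resolvent_eq[OF \<alpha> f v] resolvent_eq[OF \<alpha> f u] u v
    by (simp add: ip_simps ip_commute[of v "resolvent \<alpha> f"])
qed

text \<open>The resolvent equation tested with the resolvent itself. It says that
  \<open>resolvent_variational\<close> is an equality at \<open>v = resolvent \<alpha> f\<close>, so
  the supremum is attained.\<close>

lemma resolvent_value:
  assumes \<alpha>: "0 < \<alpha>" and f: "f \<in> l2_space m"
  shows "\<E> (resolvent \<alpha> f) (resolvent \<alpha> f) + \<alpha> * (l2_norm m (resolvent \<alpha> f))\<^sup>2 = l2_inner m f (resolvent \<alpha> f)"
  using resolvent_eq[OF \<alpha> f resolvent_domain[OF \<alpha> f]] resolvent_domain[OF \<alpha> f]
  by (simp add: form_alpha_def l2.nrm_square)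

lemma resolvent_norm_le:
  assumes \<alpha>: "0 < \<alpha>" and f: "f \<in> l2_space m"
  shows "\<alpha> * l2_norm m (resolvent \<alpha> f) \<le> l2_norm m f"
proof -
  let ?u = "resolvent \<alpha> f"
  have u: "?u \<in> \<F>" by (rule resolvent_domain[OF \<alpha> f])
  have "\<alpha> * (l2_norm m ?u)\<^sup>2 \<le> l2_inner m f ?u"
    using resolvent_value[OF \<alpha> f] form.ip_nonneg[OF u] by linarith
  also have "\<dots> \<le> l2_norm m f * l2_norm m ?u"
    using l2.Cauchy_Schwarz[OF f domain_l2'[OF u]] by linarith
  finally have "(\<alpha> * l2_norm m ?u) * l2_norm m ?u \<le> l2_norm m f * l2_norm m ?u"
    by (simp add: power2_eq_square mult.assoc)
  then show ?thesis
    using l2.nrm_nonneg[OF domain_l2'[OF u]] l2.nrm_nonneg[OF f]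
    by (cases "l2_norm m ?u = 0") auto
qed

text \<open>The sequence is bounded in the Hilbert space \<open>\<F>\<close> with shift 1, so a
  subsequence converges weakly there. Its limit agrees with \<open>v\<close> almost everywhere, and
  the domain and the form respect such equality.\<close>

lemma lower_semicontinuous:
  assumes h: "\<And>n::nat. h n \<in> \<F>" and v: "v \<in> l2_space m" and lim: "(\<lambda>n. l2_norm m (h n - v)) \<longlonglongrightarrow> 0"
    and le: "\<And>n. \<E> (h n) (h n) \<le> C"
  shows "v \<in> \<F>" and "\<E> v v \<le> C"
proof -
  interpret A: semi_hilbert \<F> "form_alpha m \<E> 1" by (rule alpha_hilbert) simp
  have "Bseq (\<lambda>n. l2_norm m (h n))"
    using l2.tendsto_nrm[OF _ v lim] h by (intro convergent_imp_Bseq convergentI) auto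
  then obtain B where B: "\<And>n. \<bar>l2_norm m (h n)\<bar> \<le> B" by (auto simp: Bseq_def)
  have "A.nrm (h n) \<le> sqrt (C + B\<^sup>2)" for n
    unfolding A.nrm_def form_alpha_def
    using le[of n] power_mono[OF B[of n], of 2] h[of n]
    by (intro real_sqrt_le_mono) (simp add: l2.nrm_square add_mono)
  then obtain r w where r: "strict_mono r" and w: "w \<in> \<F>"
    and weak: "\<And>g. g \<in> \<F> \<Longrightarrow> (\<lambda>n. form_alpha m \<E> 1 (h (r n)) g) \<longlonglongrightarrow> form_alpha m \<E> 1 w g"
    using A.weak_sequential_compactness[of h, OF h] by metis
  have lim_r: "(\<lambda>n. l2_norm m (h (r n) - v)) \<longlonglongrightarrow> 0"
    using LIMSEQ_subseq_LIMSEQ[OF lim r] by (simp add: o_def)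
  \<comment> \<open>Testing weak convergence in \<open>\<F>\<close> against
    \<open>resolvent 1 g\<close> turns the form with shift 1 into the L2 product with
    \<open>g\<close>, so both kinds of limit become visible in one sequence of numbers.\<close>
  have inner_eq: "l2_inner m w g = l2_inner m v g" if g: "g \<in> l2_space m" for g
  proof (rule LIMSEQ_unique)
    have G: "resolvent 1 g \<in> \<F>" using resolvent_domain[OF _ g] by simp
    have "form_alpha m \<E> 1 f (resolvent 1 g) = l2_inner m f g" if f: "f \<in> \<F>" for f
      using resolvent_eq[OF _ g f, of 1] A.ip_commute[OF f G] l2.ip_commute[OF domain_l2'[OF f] g] by simp
    then show "(\<lambda>n. l2_inner m (h (r n)) g) \<longlonglongrightarrow> l2_inner m w g"
      using weak[OF G] h w by simp
    show "(\<lambda>n. l2_inner m (h (r n)) g) \<longlonglongrightarrow> l2_inner m v g"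
      by (rule l2.tendsto_ip_left[OF _ v g lim_r]) (use h in auto)
  qed
  have "l2_inner m (w - v) (w - v) = 0"
    using inner_eq[of "w - v"] w v by (simp add: l2.ip_diff_left)
  then have "l2_norm m (w - v) = 0" by (simp add: l2_norm_def)
  then have wv: "AE x in m. w x = v x" using w v by (simp add: l2_norm_diff_eq_0_iff)
  show vF: "v \<in> \<F>" by (rule domain_AE[OF w v wv])
  have Ewv: "\<E> w g = \<E> v g" if "g \<in> \<F>" for g by (rule form_AE[OF w vF that wv])
  have Ev: "(\<lambda>n. \<E> (h (r n)) v) \<longlonglongrightarrow> \<E> v v"
    using tendsto_diff[OF weak[OF vF] l2.tendsto_ip_left[OF _ v v lim_r]] h Ewv[OF vF] inner_eq[OF v]
    by (simp add: form_alpha_def)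
  have lim2: "(\<lambda>n. 2 * \<E> (h (r n)) v - \<E> v v) \<longlonglongrightarrow> 2 * \<E> v v - \<E> v v"
    by (rule tendsto_diff[OF tendsto_mult_left[OF Ev] tendsto_const])
  \<comment> \<open>Nonnegativity of the form at \<open>h (r n) - v\<close> replaces the quadratic
    energy by a bound that is linear in \<open>h (r n)\<close>, hence passes to weak limits.\<close>
  have "2 * \<E> (h (r n)) v - \<E> v v \<le> C" for n
    using form.ip_nonneg[of "h (r n) - v"] h[of "r n"] vF le[of "r n"]
    by (simp add: form.ip_simps form.ip_commute[of v "h (r n)"])
  then have "2 * \<E> v v - \<E> v v \<le> C"
    by (intro LIMSEQ_le_const2[OF lim2]) blast
  then show "\<E> v v \<le> C" by simp
qed

end

section \<open>Continuity of the Laplace transform\<close>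

lemma exp_weighted_integrable:
  fixes \<phi> :: "real \<Rightarrow> real"
  assumes cont: "continuous_on {0..} \<phi>" and bdd: "\<And>t. 0 \<le> t \<Longrightarrow> \<bar>\<phi> t\<bar> \<le> M" and a: "0 < a"
  shows "(\<lambda>t. exp (- a * t) * \<phi> t) integrable_on {0..}"
proof (rule measurable_bounded_by_integrable_imp_integrable)
  show "(\<lambda>t. exp (- a * t) * \<phi> t) \<in> borel_measurable (lebesgue_on {0..})"
    by (intro continuous_imp_measurable_on_sets_lebesgue continuous_intros cont) auto
  show "(\<lambda>t. M * exp (- a * t)) integrable_on {0..}"
    using integrable_on_exp_minus_to_infinity[OF a, of 0] by (intro integrable_on_mult_right) simp
  show "norm (exp (- a * t) * \<phi> t) \<le> M * exp (- a * t)" if "t \<in> {0..}" for t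
    using bdd[of t] that by (simp add: abs_mult mult.commute)
qed auto

text \<open>Bridges two readings of an integral over the half line: the improper one used for the
  semigroup and the single integral over \<open>{0..}\<close> used for Laplace transforms.\<close>

lemma integral_truncation_tendsto:
  fixes f :: "real \<Rightarrow> real"
  assumes f: "f integrable_on {0..}" and g: "g integrable_on {0..}" and le: "\<And>t. 0 \<le> t \<Longrightarrow> \<bar>f t\<bar> \<le> g t"
  shows "(\<lambda>n. integral {0..real n} f) \<longlonglongrightarrow> integral {0..} f"
proof -
  have sub: "f integrable_on {0..real n}" for n
    using f by (rule integrable_on_subinterval) auto
  have "(\<lambda>n. integral {0..} (\<lambda>t. if t \<in> {0..real n} then f t else 0)) \<longlonglongrightarrow> integral {0..} f"
  proof (rule dominated_convergence(2)[OF _ g])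
    show "(\<lambda>t. if t \<in> {0..real n} then f t else 0) integrable_on {0..}" for n
      by (subst integrable_restrict_Int) (use sub[of n] in \<open>auto simp: Int_absorb2\<close>)
    show "norm (if t \<in> {0..real n} then f t else 0) \<le> g t" if "t \<in> {0..}" for n t
      using le[of t] that by auto
    show "(\<lambda>n. if t \<in> {0..real n} then f t else 0) \<longlonglongrightarrow> f t" if "t \<in> {0..}" for t
    proof (rule tendsto_eventually)
      obtain N :: nat where "t \<le> real N" using real_arch_simple by blast
      then have "\<forall>n\<ge>N. (if t \<in> {0..real n} then f t else 0) = f t" using that by auto
      then show "\<forall>\<^sub>F n in sequentially. (if t \<in> {0..real n} then f t else 0) = f t"
        unfolding eventually_sequentially by blast
    qed
  qed
  moreover have "integral {0..} (\<lambda>t. if t \<in> {0..real n} then f t else 0) = integral {0..real n} f" for n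
    by (subst integral_restrict_Int) (auto simp: Int_absorb2 Int_absorb1)
  ultimately show ?thesis by simp
qed

lemma laplace_tendsto_of_pointwise:
  fixes \<phi> :: "real \<Rightarrow> real" and \<phi>n :: "nat \<Rightarrow> real \<Rightarrow> real"
  assumes cont: "\<And>n. continuous_on {0..} (\<phi>n n)" and bdd: "\<And>n t. 0 \<le> t \<Longrightarrow> \<bar>\<phi>n n t\<bar> \<le> M"
    and lim: "\<And>t. 0 \<le> t \<Longrightarrow> (\<lambda>n. \<phi>n n t) \<longlonglongrightarrow> \<phi> t" and a: "0 < a"
  shows "(\<lambda>n. integral {0..} (\<lambda>t. exp (- a * t) * \<phi>n n t)) \<longlonglongrightarrow> integral {0..} (\<lambda>t. exp (- a * t) * \<phi> t)"
proof (rule dominated_convergence(2))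
  show "(\<lambda>t. exp (- a * t) * \<phi>n n t) integrable_on {0..}" for n
    by (rule exp_weighted_integrable[OF cont bdd a])
  show "(\<lambda>t. exp (- a * t) * M) integrable_on {0..}"
    by (rule exp_weighted_integrable[OF _ order_refl a]) auto
  show "norm (exp (- a * t) * \<phi>n n t) \<le> exp (- a * t) * M" if "t \<in> {0..}" for n t
    using bdd[of t n] that by (simp add: abs_mult)
  show "(\<lambda>n. exp (- a * t) * \<phi>n n t) \<longlonglongrightarrow> exp (- a * t) * \<phi> t" if "t \<in> {0..}" for t
    using lim[of t] that by (intro tendsto_intros) auto
qed

text \<open>In the variable \<open>x = exp (-t)\<close> the Laplace transform at \<open>1, 2, \<dots>\<close> gives the moments, and these
  determine the integrals of all continuous functions by the Weierstrass approximation theorem.\<close>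

lemma laplace_tendsto_continuous:
  fixes \<phi> :: "real \<Rightarrow> real" and \<phi>n :: "nat \<Rightarrow> real \<Rightarrow> real"
  assumes cont: "continuous_on {0..} \<phi>" "\<And>n. continuous_on {0..} (\<phi>n n)"
    and bdd: "\<And>t. 0 \<le> t \<Longrightarrow> \<bar>\<phi> t\<bar> \<le> M" "\<And>n t. 0 \<le> t \<Longrightarrow> \<bar>\<phi>n n t\<bar> \<le> M"
    and lim: "\<And>a. 0 < a \<Longrightarrow> (\<lambda>n. integral {0..} (\<lambda>t. exp (- a * t) * \<phi>n n t)) \<longlonglongrightarrow> integral {0..} (\<lambda>t. exp (- a * t) * \<phi> t)"
    and g: "continuous_on {0..1} g"
  shows "(\<lambda>n. integral {0..} (\<lambda>t. exp (- t) * (g (exp (- t)) * \<phi>n n t)))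
    \<longlonglongrightarrow> integral {0..} (\<lambda>t. exp (- t) * (g (exp (- t)) * \<phi> t))"
proof -
  define I where "I h \<psi> = integral {0..} (\<lambda>t. exp (- t) * (h (exp (- t)) * \<psi> t))" for h \<psi> :: "real \<Rightarrow> real"
  have cexp: "continuous_on {0..} (\<lambda>t. h (exp (- t)))" if "continuous_on {0..1} h" for h :: "real \<Rightarrow> real"
    by (rule continuous_on_compose2[OF that]) (auto intro!: continuous_intros)
  have integrable: "(\<lambda>t. exp (- t) * (h (exp (- t)) * \<psi> t)) integrable_on {0..}"
    if h: "continuous_on {0..1} h" and \<psi>: "continuous_on {0..} \<psi>" "\<And>t. 0 \<le> t \<Longrightarrow> \<bar>\<psi> t\<bar> \<le> M" for h \<psi> :: "real \<Rightarrow> real"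
  proof -
    have "compact (h ` {0..1})" by (rule compact_continuous_image[OF h]) simp
    then have "bounded (h ` {0..1})" by (rule compact_imp_bounded)
    then obtain B where "\<forall>y\<in>h ` {0..1}. norm y \<le> B" unfolding bounded_iff ..
    then have B: "\<And>x. x \<in> {0..1} \<Longrightarrow> \<bar>h x\<bar> \<le> B" by simp
    have b: "\<bar>h (exp (- t)) * \<psi> t\<bar> \<le> B * M" if "0 \<le> t" for t
      unfolding abs_mult using B[of "exp (- t)"] B[of 0] \<psi>(2)[OF that] that by (intro mult_mono) auto
    from exp_weighted_integrable[of "\<lambda>t. h (exp (- t)) * \<psi> t" "B * M" 1, OF _ b] show ?thesis
      using continuous_on_mult[OF cexp[OF h] \<psi>(1)] by simp
  qed
  \<comment> \<open>The weight \<open>exp (- t)\<close> has total mass 1 on the half line, so a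
    uniform error e in the test function costs at most \<open>e * M\<close>, whichever \<psi> is
    integrated.\<close>
  have I_diff: "\<bar>I h \<psi> - I k \<psi>\<bar> \<le> e * M"
    if h: "continuous_on {0..1} h" "continuous_on {0..1} k" "\<And>x. x \<in> {0..1} \<Longrightarrow> \<bar>h x - k x\<bar> \<le> e"
      and \<psi>: "continuous_on {0..} \<psi>" "\<And>t. 0 \<le> t \<Longrightarrow> \<bar>\<psi> t\<bar> \<le> M" for h k \<psi> e
  proof -
    have "I h \<psi> - I k \<psi> = integral {0..} (\<lambda>t. exp (- t) * (h (exp (- t)) * \<psi> t) - exp (- t) * (k (exp (- t)) * \<psi> t))"
      unfolding I_def using integrable[OF h(1) \<psi>] integrable[OF h(2) \<psi>] by (simp add: integral_diff)
    also have "norm \<dots> \<le> integral {0..} (\<lambda>t. exp (- 1 * t) * (e * M))"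
    proof (rule integral_norm_bound_integral)
      show "(\<lambda>t. exp (- t) * (h (exp (- t)) * \<psi> t) - exp (- t) * (k (exp (- t)) * \<psi> t)) integrable_on {0..}"
        by (intro integrable_diff integrable[OF h(1) \<psi>] integrable[OF h(2) \<psi>])
      show "(\<lambda>t. exp (- 1 * t) * (e * M)) integrable_on {0..}"
        by (rule exp_weighted_integrable[OF _ order_refl]) auto
      fix t :: real assume "t \<in> {0..}"
      then have "\<bar>h (exp (- t)) - k (exp (- t))\<bar> * \<bar>\<psi> t\<bar> \<le> e * M"
        using h(3)[of "exp (- t)"] \<psi>(2)[of t] by (intro mult_mono) auto
      then have "exp (- t) * (\<bar>h (exp (- t)) - k (exp (- t))\<bar> * \<bar>\<psi> t\<bar>) \<le> exp (- t) * (e * M)"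
        by (intro mult_left_mono) auto
      moreover have "exp (- t) * (h (exp (- t)) * \<psi> t) - exp (- t) * (k (exp (- t)) * \<psi> t)
          = exp (- t) * ((h (exp (- t)) - k (exp (- t))) * \<psi> t)"
        by (simp add: algebra_simps)
      ultimately show "norm (exp (- t) * (h (exp (- t)) * \<psi> t) - exp (- t) * (k (exp (- t)) * \<psi> t)) \<le> exp (- 1 * t) * (e * M)"
        by (simp add: abs_mult)
    qed
    also have "((\<lambda>t. exp (- 1 * t) * (e * M)) has_integral e * M) {0..}"
      using has_integral_mult_left[OF has_integral_exp_minus_to_infinity[of 1 0], of "e * M"] by simp
    then have "integral {0..} (\<lambda>t. exp (- 1 * t) * (e * M)) = e * M"
      by (rule integral_unique)
    finally show ?thesis by simp
  qed
  have I_poly: "(\<lambda>n. I p (\<phi>n n)) \<longlonglongrightarrow> I p \<phi>" if "real_polynomial_function p" for p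
  proof -
    from that[unfolded real_polynomial_function_iff_sum]
    obtain c N where p: "p = (\<lambda>x. \<Sum>i\<le>N. c i * x ^ i)" by (elim exE)
    \<comment> \<open>The i-th moment is the Laplace transform at \<open>1 + real i\<close>; the
      extra weight \<open>exp (- t)\<close> keeps this argument positive for i = 0.\<close>
    have exp_power: "exp (- t) * exp (- t) ^ i = exp (- (1 + real i) * t)" for t i
      by (simp add: exp_of_nat_mult[symmetric] exp_add[symmetric] algebra_simps)
    have Ip: "I p \<psi> = (\<Sum>i\<le>N. c i * integral {0..} (\<lambda>t. exp (- (1 + real i) * t) * \<psi> t))"
      if \<psi>: "continuous_on {0..} \<psi>" "\<And>t. 0 \<le> t \<Longrightarrow> \<bar>\<psi> t\<bar> \<le> M" for \<psi>
    proof -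
      have "I p \<psi> = integral {0..} (\<lambda>t. \<Sum>i\<le>N. c i * (exp (- (1 + real i) * t) * \<psi> t))"
        unfolding I_def p exp_power[symmetric] sum_distrib_left sum_distrib_right
        by (simp add: mult.assoc mult.left_commute)
      also have "\<dots> = (\<Sum>i\<le>N. integral {0..} (\<lambda>t. c i * (exp (- (1 + real i) * t) * \<psi> t)))"
        by (intro integral_sum integrable_on_mult_right exp_weighted_integrable[OF \<psi>]) auto
      finally show ?thesis by simp
    qed
    have "I p \<phi> = (\<Sum>i\<le>N. c i * integral {0..} (\<lambda>t. exp (- (1 + real i) * t) * \<phi> t))"
      "I p (\<phi>n n) = (\<Sum>i\<le>N. c i * integral {0..} (\<lambda>t. exp (- (1 + real i) * t) * \<phi>n n t))" for n
      by (intro Ip cont bdd; assumption)+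
    then show ?thesis
      by (simp only:) (intro tendsto_sum tendsto_mult_left lim; simp)
  qed
  have "(\<lambda>n. I g (\<phi>n n)) \<longlonglongrightarrow> I g \<phi>"
  proof (rule LIMSEQ_I)
    fix r :: real assume r: "0 < r"
    have M: "0 \<le> M" using bdd(1)[of 0] by simp
    define e where "e = r / (3 * (M + 1))"
    have e: "0 < e" "e * M < r / 3" using r M by (auto simp: e_def field_simps)
    obtain p where p: "real_polynomial_function p" "\<And>x. x \<in> {0..1} \<Longrightarrow> \<bar>g x - p x\<bar> < e"
      using Stone_Weierstrass_real_polynomial_function[OF _ g e(1)] by auto
    have pc: "continuous_on {0..1} p"
      using p(1) by (simp add: continuous_on_polymonial_function real_polynomial_function_eq)
    have close: "\<bar>I g \<psi> - I p \<psi>\<bar> < r / 3" if "continuous_on {0..} \<psi>" "\<And>t. 0 \<le> t \<Longrightarrow> \<bar>\<psi> t\<bar> \<le> M" for \<psi>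
      using I_diff[OF g pc less_imp_le[OF p(2)] that] e(2) by simp
    obtain N where N: "\<And>n. n \<ge> N \<Longrightarrow> norm (I p (\<phi>n n) - I p \<phi>) < r / 3"
      using LIMSEQ_D[OF I_poly[OF p(1)], of "r / 3"] r by auto
    have "norm (I g (\<phi>n n) - I g \<phi>) < r" if "n \<ge> N" for n
      using N[OF that] close[of \<phi>, OF cont(1) bdd(1), simplified] close[of "\<phi>n n", OF cont(2) bdd(2), simplified]
      unfolding real_norm_def abs_less_iff by argo
    then show "\<exists>N. \<forall>n\<ge>N. norm (I g (\<phi>n n) - I g \<phi>) < r" by blast
  qed
  then show ?thesis by (simp add: I_def)
qed

text \<open>As for distribution functions at continuity points: the average of a decreasing function
  against a bump on an interval lies between its values at the two ends, and the averages
  converge.\<close>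

theorem pointwise_tendsto_of_laplace:
  fixes \<phi> :: "real \<Rightarrow> real" and \<phi>n :: "nat \<Rightarrow> real \<Rightarrow> real"
  assumes cont: "continuous_on {0..} \<phi>" "\<And>n. continuous_on {0..} (\<phi>n n)"
    and bdd: "\<And>t. 0 \<le> t \<Longrightarrow> \<bar>\<phi> t\<bar> \<le> M" "\<And>n t. 0 \<le> t \<Longrightarrow> \<bar>\<phi>n n t\<bar> \<le> M"
    and anti: "\<And>s t. 0 \<le> s \<Longrightarrow> s \<le> t \<Longrightarrow> \<phi> t \<le> \<phi> s" "\<And>n s t. 0 \<le> s \<Longrightarrow> s \<le> t \<Longrightarrow> \<phi>n n t \<le> \<phi>n n s"
    and lim: "\<And>a. 0 < a \<Longrightarrow> (\<lambda>n. integral {0..} (\<lambda>t. exp (- a * t) * \<phi>n n t)) \<longlonglongrightarrow> integral {0..} (\<lambda>t. exp (- a * t) * \<phi> t)"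
    and t: "0 < t"
  shows "(\<lambda>n. \<phi>n n t) \<longlonglongrightarrow> \<phi> t"
proof -
  \<comment> \<open>One bump on \<open>{t1..t2}\<close> yields a bound in each direction. The upper
    bound is later used on an interval ending at t, the lower bound on one starting there.\<close>
  have squeeze: "(\<forall>\<^sub>F n in sequentially. \<phi>n n t2 < \<phi> t1 + e) \<and> (\<forall>\<^sub>F n in sequentially. \<phi> t2 - e < \<phi>n n t1)"
    if t12: "0 \<le> t1" "t1 < t2" and e: "0 < e" for t1 t2 e :: real
  proof -
    \<comment> \<open>In the variable x = exp (-s) this is a continuous bump, positive exactly
      between \<open>exp (- t2)\<close> and \<open>exp (- t1)\<close>, so that \<open>k\<close>
      vanishes outside \<open>{t1..t2}\<close>.\<close>
    define g where "g x = max 0 ((x - exp (- t2)) * (exp (- t1) - x))" for x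
    define k where "k s = exp (- s) * g (exp (- s))" for s
    have kc: "continuous_on S k" for S
      unfolding k_def g_def by (intro continuous_intros)
    have k0: "k s = 0" if "s \<notin> {t1..t2}" for s
    proof -
      have "(exp (- s) - exp (- t2)) * (exp (- t1) - exp (- s)) \<le> 0"
        using that t12 by (auto simp: mult_le_0_iff)
      then show ?thesis by (simp add: k_def g_def)
    qed
    have k_nonneg: "0 \<le> k s" for s by (simp add: k_def g_def)
    have restrict: "integral {0..} (\<lambda>s. k s * \<psi> s) = integral {t1..t2} (\<lambda>s. k s * \<psi> s)" for \<psi>
    proof -
      have "integral {0..} (\<lambda>s. k s * \<psi> s) = integral {0..} (\<lambda>s. if s \<in> {t1..t2} then k s * \<psi> s else 0)"
        by (rule integral_cong) (use k0 in auto)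
      also have "\<dots> = integral {t1..t2} (\<lambda>s. k s * \<psi> s)"
        using t12 by (subst integral_restrict_Int) (auto simp: Int_absorb1)
      finally show ?thesis .
    qed
    define C where "C = integral {t1..t2} k"
    have "k ((t1 + t2) / 2) > 0"
      using t12 by (simp add: k_def g_def less_max_iff_disj)
    moreover have "(t1 + t2) / 2 \<in> {t1..t2}" using t12 by auto
    ultimately have "\<not> (\<forall>s\<in>{t1..t2}. k s = 0)" by (metis less_irrefl)
    then have "C \<noteq> 0"
      using t12 integral_eq_0_iff[OF kc, of t1 t2] k_nonneg unfolding C_def by simp
    moreover have "0 \<le> C" unfolding C_def by (rule integral_nonneg) (use kc k_nonneg in \<open>auto intro: integrable_continuous_interval\<close>)
    ultimately have C: "0 < C" by simp
    have bounds: "\<psi> t2 * C \<le> integral {0..} (\<lambda>s. k s * \<psi> s) \<and> integral {0..} (\<lambda>s. k s * \<psi> s) \<le> \<psi> t1 * C"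
      if \<psi>: "continuous_on {0..} \<psi>" "\<And>s t. 0 \<le> s \<Longrightarrow> s \<le> t \<Longrightarrow> \<psi> t \<le> \<psi> s" for \<psi> :: "real \<Rightarrow> real"
    proof -
      have \<psi>c: "continuous_on {t1..t2} \<psi>" using \<psi>(1) by (rule continuous_on_subset) (use t12 in auto)
      have 1: "integral {t1..t2} (\<lambda>s. k s * \<psi> t2) \<le> integral {t1..t2} (\<lambda>s. k s * \<psi> s)"
        by (intro integral_le integrable_continuous_interval continuous_intros kc \<psi>c mult_left_mono k_nonneg \<psi>(2)) (use t12 in auto)
      have 2: "integral {t1..t2} (\<lambda>s. k s * \<psi> s) \<le> integral {t1..t2} (\<lambda>s. k s * \<psi> t1)"
        by (intro integral_le integrable_continuous_interval continuous_intros kc \<psi>c mult_left_mono k_nonneg \<psi>(2)) (use t12 in auto)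
      show ?thesis using 1 2 unfolding restrict by (simp add: C_def mult.commute)
    qed
    have L: "(\<lambda>n. integral {0..} (\<lambda>s. k s * \<phi>n n s)) \<longlonglongrightarrow> integral {0..} (\<lambda>s. k s * \<phi> s)"
      using laplace_tendsto_continuous[OF cont bdd lim, of g] unfolding k_def g_def mult.assoc
      by (simp add: continuous_intros)
    have up: "\<forall>\<^sub>F n in sequentially. integral {0..} (\<lambda>s. k s * \<phi>n n s) < (\<phi> t1 + e) * C"
      using bounds[OF cont(1) anti(1)] C mult_pos_pos[OF e C] by (intro order_tendstoD(2)[OF L]) (simp add: algebra_simps)
    have lo: "\<forall>\<^sub>F n in sequentially. (\<phi> t2 - e) * C < integral {0..} (\<lambda>s. k s * \<phi>n n s)"
      using bounds[OF cont(1) anti(1)] C mult_pos_pos[OF e C] by (intro order_tendstoD(1)[OF L]) (simp add: algebra_simps)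
    show ?thesis
    proof
      show "\<forall>\<^sub>F n in sequentially. \<phi>n n t2 < \<phi> t1 + e"
        using up
      proof eventually_elim
        case (elim n)
        then have "\<phi>n n t2 * C < (\<phi> t1 + e) * C" using bounds[OF cont(2)[of n] anti(2)] by simp
        then show ?case using C by simp
      qed
      show "\<forall>\<^sub>F n in sequentially. \<phi> t2 - e < \<phi>n n t1"
        using lo
      proof eventually_elim
        case (elim n)
        then have "(\<phi> t2 - e) * C < \<phi>n n t1 * C" using bounds[OF cont(2)[of n] anti(2)] by simp
        then show ?case using C by simp
      qed
    qed
  qed
  show ?thesis
  proof (rule LIMSEQ_I)
    fix r :: real assume r: "0 < r"
    have "isCont \<phi> t" using cont(1) t by (intro continuous_on_interior[of "{0..}"]) auto
    then have "\<exists>d>0. \<forall>s. dist s t < d \<longrightarrow> dist (\<phi> s) (\<phi> t) < r / 2"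
      using half_gt_zero[OF r] unfolding continuous_at_eps_delta by blast
    then obtain d where d: "0 < d" "\<And>s. \<bar>s - t\<bar> < d \<Longrightarrow> \<bar>\<phi> s - \<phi> t\<bar> < r / 2"
      unfolding dist_real_def by blast
    \<comment> \<open>Bounded by t so that \<open>t - h\<close> stays in the domain, and by
      \<open>d / 2\<close> so that both neighbours are strictly within \<open>d\<close> of
      t.\<close>
    define h where "h = min t (d / 2)"
    have h: "0 < h" "h \<le> t" "h < d" using d t by (auto simp: h_def)
    have "\<forall>\<^sub>F n in sequentially. \<phi>n n t < \<phi> (t - h) + r / 2" "\<forall>\<^sub>F n in sequentially. \<phi> (t + h) - r / 2 < \<phi>n n t"
      using squeeze[of "t - h" t "r / 2"] squeeze[of t "t + h" "r / 2"] h r t by auto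
    then have "\<forall>\<^sub>F n in sequentially. norm (\<phi>n n t - \<phi> t) < r"
    proof eventually_elim
      case (elim n)
      have "\<bar>\<phi> (t - h) - \<phi> t\<bar> < r / 2" "\<bar>\<phi> (t + h) - \<phi> t\<bar> < r / 2"
        using d(2)[of "t - h"] d(2)[of "t + h"] h by auto
      then show ?case using elim unfolding real_norm_def abs_less_iff by argo
    qed
    then show "\<exists>N. \<forall>n\<ge>N. norm (\<phi>n n t - \<phi> t) < r" by (simp add: eventually_sequentially)
  qed
qed

section \<open>Semigroups and their diagonal functions\<close>

lemma l2_norm_cong_AE:
  assumes "f \<in> l2_space m" "g \<in> l2_space m" "AE x in m. f x = g x"
  shows "l2_norm m f = l2_norm m g"
  using l2_inner_cong_AE[OF assms(1,2,1,3)] l2_inner_cong_AE[OF assms(1,2,2,3)]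
    l2.ip_commute[OF assms(1,2)] by (simp add: l2_norm_def)

text \<open>Pairing with \<open>g\<close> is linear and bounded, so convergence of the L2-valued
  Riemann sums gives convergence of the real ones along the same filter, which is
  \<open>has_integral\<close>.\<close>

lemma l2_has_integral_upto_inner:
  assumes int: "l2_has_integral_upto m u v T" and u: "\<And>t. 0 \<le> t \<Longrightarrow> u t \<in> l2_space m" and g: "g \<in> l2_space m"
  shows "((\<lambda>t. l2_inner m (u t) g) has_integral l2_inner m v g) {0..T}"
proof -
  define S where "S p = (\<lambda>x. \<Sum>(t,K)\<in>p. measure lborel K * u t x)" for p :: "(real \<times> real set) set"
  have v: "v \<in> l2_space m" and lim: "((\<lambda>p. l2_norm m (S p - v)) \<longlongrightarrow> 0) (division_filter (cbox 0 T))"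
    using int by (auto simp: l2_has_integral_upto_def S_def fun_diff_def)
  have S: "S p \<in> l2_space m \<and> l2_inner m (S p) g = (\<Sum>(t,K)\<in>p. measure lborel K *\<^sub>R l2_inner m (u t) g)"
    if "p tagged_division_of (cbox 0 T)" for p
  proof -
    \<comment> \<open>Removing one piece from a tagged division does not leave a tagged division, so
      the induction runs on what survives: finiteness and nonnegative tags.\<close>
    have "\<forall>(t,K)\<in>p. 0 \<le> t"
      using tag_in_interval[OF that] by auto
    with tagged_division_of_finite[OF that]
    show ?thesis
    proof (induction p)
      case empty
      show ?case using l2.mem(1)[of m] l2.ip_zero_left[OF g] by (simp add: S_def zero_fun_def)
    next
      case (insert q p)
      obtain t K where q: "q = (t, K)" by fastforce
      have Sq: "S (insert q p) = measure lborel K *\<^sub>R u t + S p"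
        using insert.hyps by (simp add: S_def q plus_fun_def scaleR_fun_def)
      have ut: "u t \<in> l2_space m" and Sp: "S p \<in> l2_space m"
        and inner: "l2_inner m (S p) g = (\<Sum>(t,K)\<in>p. measure lborel K *\<^sub>R l2_inner m (u t) g)"
        using insert u[of t] by (auto simp: q)
      have "S (insert q p) \<in> l2_space m"
        unfolding Sq by (rule l2.mem(2)[OF l2.mem(4)[OF ut] Sp])
      moreover have "l2_inner m (S (insert q p)) g = measure lborel K * l2_inner m (u t) g + l2_inner m (S p) g"
        unfolding Sq l2.ip_add_left[OF l2.mem(4)[OF ut] Sp g] l2.ip_scale_left[OF ut g] ..
      ultimately show ?case
        using insert.hyps inner by (simp add: q)
    qed
  qed
  have "((\<lambda>p. (\<Sum>(t,K)\<in>p. measure lborel K *\<^sub>R l2_inner m (u t) g) - l2_inner m v g) \<longlongrightarrow> 0) (division_filter (cbox 0 T))"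
  proof (rule tendsto_0_le[OF lim, of _ "l2_norm m g"])
    show "\<forall>\<^sub>F p in division_filter (cbox 0 T).
        norm ((\<Sum>(t,K)\<in>p. measure lborel K *\<^sub>R l2_inner m (u t) g) - l2_inner m v g)
        \<le> norm (l2_norm m (S p - v)) * l2_norm m g"
      using eventually_division_filter_tagged_division[of "cbox 0 T"]
    proof eventually_elim
      case (elim p)
      note Sp = S[OF elim]
      have "l2_inner m (S p - v) g = (\<Sum>(t,K)\<in>p. measure lborel K *\<^sub>R l2_inner m (u t) g) - l2_inner m v g"
        using Sp v g by (simp add: l2.ip_diff_left)
      then show ?case
        using l2.Cauchy_Schwarz[of "S p - v" m g] l2.nrm_nonneg[of "S p - v" m] Sp v g by auto
    qed
  qed
  then have "((\<lambda>t. l2_inner m (u t) g) has_integral l2_inner m v g) (cbox 0 T)"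
    unfolding has_integral_cbox by (simp add: LIM_zero_iff)
  then show ?thesis by simp
qed

locale l2_semigroup =
  fixes m :: "'a measure" and H P
  assumes subspace_H: "subspace H" and H_l2: "H \<subseteq> l2_space m"
    and semigroup: "symmetric_contraction_semigroup m H P"
begin

lemma H_l2' [simp, intro]: "f \<in> H \<Longrightarrow> f \<in> l2_space m"
  using H_l2 by (rule subsetD)

lemma semigroupD:
  shows "\<forall>t\<ge>0. \<forall>f\<in>H. P t f \<in> H"
    and "\<forall>t\<ge>0. \<forall>f\<in>H. \<forall>g\<in>H. \<forall>a b. AE x in m. P t (a *\<^sub>R f + b *\<^sub>R g) x = (a *\<^sub>R P t f + b *\<^sub>R P t g) x"
    and "\<forall>f\<in>H. AE x in m. P 0 f x = f x"
    and "\<forall>s\<ge>0. \<forall>t\<ge>0. \<forall>f\<in>H. AE x in m. P (s + t) f x = P s (P t f) x"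
    and "\<forall>t\<ge>0. \<forall>f\<in>H. l2_norm m (P t f) \<le> l2_norm m f"
    and "\<forall>t\<ge>0. \<forall>f\<in>H. \<forall>g\<in>H. l2_inner m (P t f) g = l2_inner m f (P t g)"
    and "\<forall>f\<in>H. ((\<lambda>t. l2_norm m (P t f - f)) \<longlongrightarrow> 0) (at_right 0)"
proof -
  note c0 = semigroup[unfolded symmetric_contraction_semigroup_def]
  note c1 = conjunct2[OF c0]
  note c2 = conjunct2[OF c1]
  note c3 = conjunct2[OF c2]
  note c4 = conjunct2[OF c3]
  note c5 = conjunct2[OF c4]
  note c6 = conjunct2[OF c5]
  show "\<forall>t\<ge>0. \<forall>f\<in>H. P t f \<in> H"
    and "\<forall>t\<ge>0. \<forall>f\<in>H. \<forall>g\<in>H. \<forall>a b. AE x in m. P t (a *\<^sub>R f + b *\<^sub>R g) x = (a *\<^sub>R P t f + b *\<^sub>R P t g) x"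
    and "\<forall>f\<in>H. AE x in m. P 0 f x = f x"
    and "\<forall>s\<ge>0. \<forall>t\<ge>0. \<forall>f\<in>H. AE x in m. P (s + t) f x = P s (P t f) x"
    and "\<forall>t\<ge>0. \<forall>f\<in>H. l2_norm m (P t f) \<le> l2_norm m f"
    and "\<forall>t\<ge>0. \<forall>f\<in>H. \<forall>g\<in>H. l2_inner m (P t f) g = l2_inner m f (P t g)"
    and "\<forall>f\<in>H. ((\<lambda>t. l2_norm m (P t f - f)) \<longlongrightarrow> 0) (at_right 0)"
    unfolding fun_space_defs real_scaleR_def
    by (rule conjunct1[OF c0] conjunct1[OF c1] conjunct1[OF c2] conjunct1[OF c3] conjunct1[OF c4] conjunct1[OF c5] c6)+
qed

lemma P_mem [simp, intro]: "0 \<le> t \<Longrightarrow> f \<in> H \<Longrightarrow> P t f \<in> H"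
  using semigroupD(1) by blast

lemma P_contraction: "0 \<le> t \<Longrightarrow> f \<in> H \<Longrightarrow> l2_norm m (P t f) \<le> l2_norm m f"
  using semigroupD(5) by blast

lemma P_symmetric: "0 \<le> t \<Longrightarrow> f \<in> H \<Longrightarrow> g \<in> H \<Longrightarrow> l2_inner m (P t f) g = l2_inner m f (P t g)"
  using semigroupD(6) by blast

text \<open>The laws of the semigroup hold only almost everywhere; under an inner product they
  become equations between numbers. The next two lemmas serve the same purpose.\<close>

lemma inner_P_linear:
  assumes "0 \<le> t" "f \<in> H" "g \<in> H" "h \<in> l2_space m"
  shows "l2_inner m (P t (a *\<^sub>R f + b *\<^sub>R g)) h = a * l2_inner m (P t f) h + b * l2_inner m (P t g) h"
proof -
  have "a *\<^sub>R f + b *\<^sub>R g \<in> H"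
    using assms subspace_H by (simp add: subspace_add subspace_scale)
  moreover have "AE x in m. P t (a *\<^sub>R f + b *\<^sub>R g) x = (a *\<^sub>R P t f + b *\<^sub>R P t g) x"
    using semigroupD(2) assms(1-3) by blast
  ultimately have "l2_inner m (P t (a *\<^sub>R f + b *\<^sub>R g)) h = l2_inner m (a *\<^sub>R P t f + b *\<^sub>R P t g) h"
    using assms by (intro l2_inner_cong_AE) auto
  then show ?thesis using assms by (simp add: l2.ip_simps)
qed

lemma inner_P_zero: "f \<in> H \<Longrightarrow> h \<in> l2_space m \<Longrightarrow> l2_inner m (P 0 f) h = l2_inner m f h"
  using semigroupD(3) by (intro l2_inner_cong_AE) auto

lemma inner_P_add:
  assumes "0 \<le> s" "0 \<le> t" "f \<in> H" "g \<in> H"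
  shows "l2_inner m (P (s + t) f) g = l2_inner m (P t f) (P s g)"
proof -
  have "AE x in m. P (s + t) f x = P s (P t f) x" using semigroupD(4) assms by blast
  then have "l2_inner m (P (s + t) f) g = l2_inner m (P s (P t f)) g"
    using assms by (intro l2_inner_cong_AE) auto
  also have "\<dots> = l2_inner m (P t f) (P s g)" using assms by (intro P_symmetric) auto
  finally show ?thesis .
qed

lemma norm_P_antimono:
  assumes "0 \<le> s" "s \<le> t" "f \<in> H"
  shows "l2_norm m (P t f) \<le> l2_norm m (P s f)"
proof -
  have "AE x in m. P (t - s + s) f x = P (t - s) (P s f) x"
    using semigroupD(4) assms diff_ge_0_iff_ge by blast
  then have "l2_norm m (P t f) = l2_norm m (P (t - s) (P s f))"
    using assms by (intro l2_norm_cong_AE) auto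
  also have "\<dots> \<le> l2_norm m (P s f)" using assms by (intro P_contraction) auto
  finally show ?thesis .
qed

definition diag :: "('a \<Rightarrow> real) \<Rightarrow> real \<Rightarrow> real" where
  "diag f t = l2_inner m (P t f) f"

lemma diag_eq_norm: "0 \<le> t \<Longrightarrow> f \<in> H \<Longrightarrow> diag f t = (l2_norm m (P (t / 2) f))\<^sup>2"
  using inner_P_add[of "t / 2" "t / 2" f f] by (simp add: diag_def l2.nrm_square)

lemma diag_antimono: "0 \<le> s \<Longrightarrow> s \<le> t \<Longrightarrow> f \<in> H \<Longrightarrow> diag f t \<le> diag f s"
  using norm_P_antimono[of "s / 2" "t / 2" f] by (simp add: diag_eq_norm power_mono)

lemma diag_bounded: "0 \<le> t \<Longrightarrow> f \<in> H \<Longrightarrow> \<bar>diag f t\<bar> \<le> (l2_norm m f)\<^sup>2"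
  using P_contraction[of "t / 2" f] by (simp add: diag_eq_norm power_mono)

lemma diag_zero: "f \<in> H \<Longrightarrow> diag f 0 = (l2_norm m f)\<^sup>2"
  by (simp add: diag_def inner_P_zero l2.nrm_square)

text \<open>By the semigroup law and symmetry, the increment from s to t is the product of
  \<open>P (t - s) f - f\<close> with \<open>P s f\<close>. Contraction makes the bound uniform in
  s, so strong continuity at 0 suffices.\<close>

lemma continuous_on_diag:
  assumes f: "f \<in> H"
  shows "continuous_on {0..} (diag f)"
proof -
  have le: "\<bar>diag f t - diag f s\<bar> \<le> l2_norm m (P (t - s) f - f) * l2_norm m f" if "0 \<le> s" "s \<le> t" for s t
  proof -
    have "diag f t = l2_inner m (P (t - s) f) (P s f)"
      using inner_P_add[of s "t - s" f f] that f by (simp add: diag_def)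
    moreover have "diag f s = l2_inner m f (P s f)"
      using that f by (simp add: diag_def P_symmetric)
    ultimately have "diag f t - diag f s = l2_inner m (P (t - s) f - f) (P s f)"
      using that f by (simp add: l2.ip_diff_left)
    also have "\<bar>\<dots>\<bar> \<le> l2_norm m (P (t - s) f - f) * l2_norm m (P s f)"
      using that f by (intro l2.Cauchy_Schwarz) auto
    also have "\<dots> \<le> l2_norm m (P (t - s) f - f) * l2_norm m f"
      using that f by (intro mult_left_mono P_contraction l2.nrm_nonneg l2.mem) auto
    finally show ?thesis .
  qed
  have lim: "((\<lambda>t. l2_norm m (P t f - f) * l2_norm m f) \<longlongrightarrow> 0) (at_right 0)"
    using semigroupD(7) f by (intro tendsto_mult_left_zero) blast
  have small: "\<exists>d>0. \<forall>h>0. h < d \<longrightarrow> l2_norm m (P h f - f) * l2_norm m f < e" if "0 < e" for e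
    using order_tendstoD(2)[OF lim that] unfolding eventually_at_right_field .
  show ?thesis
    unfolding continuous_on_iff
  proof (intro ballI allI impI)
    fix s e :: real assume s: "s \<in> {0..}" and e: "0 < e"
    obtain d where d: "0 < d" "\<And>h. 0 < h \<Longrightarrow> h < d \<Longrightarrow> l2_norm m (P h f - f) * l2_norm m f < e"
      using small[OF e] by blast
    have "dist (diag f t) (diag f s) < e" if t: "t \<in> {0..}" "dist t s < d" for t
    proof (cases t s rule: linorder_cases)
      case less
      then show ?thesis using le[of t s] d(2)[of "s - t"] t s by (auto simp: dist_real_def abs_minus_commute)
    next
      case greater
      then show ?thesis using le[of s t] d(2)[of "t - s"] t s by (auto simp: dist_real_def)
    qed (use e in simp)
    then show "\<exists>d>0. \<forall>t\<in>{0..}. dist t s < d \<longrightarrow> dist (diag f t) (diag f s) < e" using d(1) by blast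
  qed
qed

lemma inner_P_polarization:
  assumes "0 \<le> t" "f \<in> H" "g \<in> H"
  shows "l2_inner m (P t f) g = (diag (f + g) t - diag (f - g) t) / 4"
proof -
  have "l2_inner m (P t (f + g)) h = l2_inner m (P t f) h + l2_inner m (P t g) h"
    and "l2_inner m (P t (f - g)) h = l2_inner m (P t f) h - l2_inner m (P t g) h" if "h \<in> l2_space m" for h
    using inner_P_linear[OF assms that, of 1 1] inner_P_linear[OF assms that, of 1 "-1"] by simp_all
  moreover have "l2_inner m (P t g) f = l2_inner m (P t f) g"
    using P_symmetric[OF assms] l2.ip_commute[of f m "P t g"] assms by simp
  ultimately show ?thesis
    using assms by (simp add: diag_def l2.ip_simps)
qed

end

locale form_semigroup = closed_form +
  fixes P
  assumes associated: "associated_semigroup m \<E> \<F> P"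
begin

sublocale l2_semigroup m "l2_closure m \<F>" P
  using associated subspace_l2_closure[OF form.subspace domain_l2] l2_closure_subset
  by unfold_locales (simp_all add: associated_semigroup_def)

text \<open>The integral of \<open>exp (- \<alpha> * t) * diag f t\<close> over
  \<open>{0..T}\<close> is the product of f with the L2-valued integral up to T. Along integers T
  tending to infinity this has two limits, which must coincide.\<close>

lemma laplace_diag:
  assumes \<alpha>: "0 < \<alpha>" and f: "f \<in> l2_closure m \<F>"
  shows "integral {0..} (\<lambda>t. exp (- \<alpha> * t) * diag f t) = l2_inner m (resolvent \<alpha> f) f"
proof -
  have fl2: "f \<in> l2_space m" using f by blast
  define u where "u t = exp (- \<alpha> * t) *\<^sub>R P t f" for t
  have ul2: "u t \<in> l2_space m" if "0 \<le> t" for t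
    using that f by (auto simp: u_def)
  have u_inner: "l2_inner m (u t) f = exp (- \<alpha> * t) * diag f t" if "0 \<le> t" for t
    using that f by (simp add: u_def diag_def l2.ip_scale_left)
  have "l2_has_integral_halfline m u (resolvent \<alpha> f)"
  proof -
    have "u = (\<lambda>t x. exp (- \<alpha> * t) * P t f x)"
      by (simp add: fun_eq_iff u_def scaleR_fun_def)
    then show ?thesis using associated \<alpha> f by (simp add: associated_semigroup_def)
  qed
  then obtain w where w: "\<And>T. 0 \<le> T \<Longrightarrow> l2_has_integral_upto m u (w T) T"
    and wlim: "((\<lambda>T. l2_norm m (w T - resolvent \<alpha> f)) \<longlongrightarrow> 0) at_top"
    unfolding l2_has_integral_halfline_def fun_diff_def by blast
  have "integral {0..T} (\<lambda>t. exp (- \<alpha> * t) * diag f t) = l2_inner m (w T) f" if "0 \<le> T" for T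
    by (rule integral_unique, rule has_integral_eq[OF _ l2_has_integral_upto_inner[OF w[OF that] ul2 fl2]])
      (simp_all add: u_inner)
  moreover have "(\<lambda>n. l2_inner m (w (real n)) f) \<longlonglongrightarrow> l2_inner m (resolvent \<alpha> f) f"
  proof (rule l2.tendsto_ip_left)
    show "w (real n) \<in> l2_space m" for n
      using w[of "real n"] by (simp add: l2_has_integral_upto_def)
    show "(\<lambda>n. l2_norm m (w (real n) - resolvent \<alpha> f)) \<longlonglongrightarrow> 0"
      using filterlim_compose[OF wlim filterlim_real_sequentially] .
  qed (use resolvent_domain[OF \<alpha> fl2] fl2 in auto)
  moreover have "(\<lambda>n. integral {0..real n} (\<lambda>t. exp (- \<alpha> * t) * diag f t))
      \<longlonglongrightarrow> integral {0..} (\<lambda>t. exp (- \<alpha> * t) * diag f t)"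
  proof (rule integral_truncation_tendsto)
    show "(\<lambda>t. exp (- \<alpha> * t) * diag f t) integrable_on {0..}"
      by (rule exp_weighted_integrable[OF continuous_on_diag[OF f] diag_bounded[OF _ f] \<alpha>])
    show "(\<lambda>t. exp (- \<alpha> * t) * (l2_norm m f)\<^sup>2) integrable_on {0..}"
      by (rule exp_weighted_integrable[OF _ order_refl \<alpha>]) simp
    show "\<bar>exp (- \<alpha> * t) * diag f t\<bar> \<le> exp (- \<alpha> * t) * (l2_norm m f)\<^sup>2" if "0 \<le> t" for t
      using diag_bounded[OF that f] by (simp add: abs_mult)
  qed
  ultimately show ?thesis
    by (simp add: LIMSEQ_unique)
qed

end

section \<open>Mosco convergence and convergence of resolvents\<close>

lemma l2_tendsto_altdef: "l2_tendsto m u v \<longleftrightarrow> (\<lambda>n. l2_norm m (u n - v)) \<longlonglongrightarrow> 0"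
  by (simp add: l2_tendsto_def fun_diff_def)

text \<open>Mosco's lower bound speaks of full sequences, whereas compactness yields a subsequence.
  Putting the limit at the missing indices restores a full sequence.\<close>

lemma LIMSEQ_fill_subsequence:
  assumes q: "strict_mono (q :: nat \<Rightarrow> nat)" and lim: "(\<lambda>k. a (q k)) \<longlonglongrightarrow> (l :: real)"
  shows "(\<lambda>n. if n \<in> range q then a n else l) \<longlonglongrightarrow> l"
proof (rule LIMSEQ_I)
  fix e :: real assume e: "0 < e"
  obtain K where K: "\<And>k. k \<ge> K \<Longrightarrow> norm (a (q k) - l) < e"
    using LIMSEQ_D[OF lim e] by blast
  have "norm ((if n \<in> range q then a n else l) - l) < e" if n: "n \<ge> q K" for n
  proof (cases "n \<in> range q")
    case True
    then obtain k where k: "n = q k" by blast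
    then have "k \<ge> K" using n strict_mono_less_eq[OF q] by simp
    then show ?thesis using K[of k] k by simp
  qed (use e in simp)
  then show "\<exists>N. \<forall>n\<ge>N. norm ((if n \<in> range q then a n else l) - l) < e" by blast
qed

locale form_sequence = closed_form m \<E> \<F> for m :: "'a measure" and \<E> \<F> +
  fixes \<E>n :: "nat \<Rightarrow> ('a \<Rightarrow> real) \<Rightarrow> ('a \<Rightarrow> real) \<Rightarrow> real" and \<F>n :: "nat \<Rightarrow> ('a \<Rightarrow> real) set"
  assumes closed_form_n: "\<And>n. closed_form m (\<E>n n) (\<F>n n)"
begin

sublocale n: closed_form m "\<E>n n" "\<F>n n" for n
  by (rule closed_form_n)

definition value_tendsto :: "real \<Rightarrow> ('a \<Rightarrow> real) \<Rightarrow> bool" where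
  "value_tendsto \<alpha> f \<longleftrightarrow> (\<lambda>n. l2_inner m f (n.resolvent n \<alpha> f)) \<longlonglongrightarrow> l2_inner m f (resolvent \<alpha> f)"

lemma form_energy_less_iff:
  "form_energy (\<E>n n) (\<F>n n) u < ereal c \<longleftrightarrow> u \<in> \<F>n n \<and> \<E>n n u u < c"
  by (simp add: form_energy_def)

text \<open>A recovery sequence for \<open>resolvent \<alpha> f\<close> consists of competitors in
  the variational problems of the approximating forms. Half of e covers the energy, half the L2
  terms.\<close>

lemma value_lower:
  assumes mosco: "\<exists>u. (\<forall>n. u n \<in> l2_space m) \<and> l2_tendsto m u (resolvent \<alpha> f) \<and>
      limsup (\<lambda>n. form_energy (\<E>n n) (\<F>n n) (u n)) \<le> form_energy \<E> \<F> (resolvent \<alpha> f)"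
    and \<alpha>: "0 < \<alpha>" and f: "f \<in> l2_space m" and e: "0 < e"
  shows "\<forall>\<^sub>F n in sequentially. l2_inner m f (resolvent \<alpha> f) - e < l2_inner m f (n.resolvent n \<alpha> f)"
proof -
  define R where "R = resolvent \<alpha> f"
  have R: "R \<in> \<F>" unfolding R_def by (rule resolvent_domain[OF \<alpha> f])
  have Rv: "\<E> R R + \<alpha> * (l2_norm m R)\<^sup>2 = l2_inner m f R" unfolding R_def by (rule resolvent_value[OF \<alpha> f])
  obtain u where u: "\<And>n. u n \<in> l2_space m" and lim: "(\<lambda>n. l2_norm m (u n - R)) \<longlonglongrightarrow> 0"
    and sup: "limsup (\<lambda>n. form_energy (\<E>n n) (\<F>n n) (u n)) \<le> ereal (\<E> R R)"
    using mosco R by (auto simp: R_def[symmetric] l2_tendsto_altdef form_energy_def)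
  have "limsup (\<lambda>n. form_energy (\<E>n n) (\<F>n n) (u n)) < ereal (\<E> R R + e / 2)"
    using e by (intro le_less_trans[OF sup]) simp
  then have ev: "\<forall>\<^sub>F n in sequentially. form_energy (\<E>n n) (\<F>n n) (u n) < ereal (\<E> R R + e / 2)"
    by (rule Limsup_lessD)
  have "(\<lambda>n. 2 * l2_inner m (u n) f - \<alpha> * (l2_norm m (u n))\<^sup>2) \<longlonglongrightarrow> 2 * l2_inner m R f - \<alpha> * (l2_norm m R)\<^sup>2"
    using R f u lim by (intro tendsto_intros l2.tendsto_ip_left l2.tendsto_nrm) auto
  then have "\<forall>\<^sub>F n in sequentially. 2 * l2_inner m R f - \<alpha> * (l2_norm m R)\<^sup>2 - e / 2
      < 2 * l2_inner m (u n) f - \<alpha> * (l2_norm m (u n))\<^sup>2"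
    by (rule order_tendstoD(1)) (use e in simp)
  with ev show ?thesis
    unfolding R_def[symmetric]
  proof eventually_elim
    case (elim n)
    then have un: "u n \<in> \<F>n n" and En: "\<E>n n (u n) (u n) < \<E> R R + e / 2"
      by (simp_all add: form_energy_less_iff)
    have "2 * l2_inner m f (u n) - (\<E>n n (u n) (u n) + \<alpha> * (l2_norm m (u n))\<^sup>2) \<le> l2_inner m f (n.resolvent n \<alpha> f)"
      using n.resolvent_variational[OF \<alpha> f un] u by (simp add: form_alpha_def l2.nrm_square)
    moreover have "l2_inner m R f = l2_inner m f R" "l2_inner m (u n) f = l2_inner m f (u n)"
      using f u R by (auto intro: l2.ip_commute)
    ultimately show ?case
      using elim(2) En Rv by (smt (verit) field_sum_of_halves)
  qed
qed

text \<open>If the values exceeded the limit value by e infinitely often, a weak limit w of the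
  maximizers would, by Mosco's lower bound, be a competitor for \<open>\<E>\<close> whose value
  exceeds the supremum.\<close>

lemma value_upper:
  assumes mosco: "\<And>u v. (\<And>n. u n \<in> l2_space m) \<Longrightarrow> v \<in> l2_space m \<Longrightarrow> l2_weak_tendsto m u v \<Longrightarrow>
      form_energy \<E> \<F> v \<le> liminf (\<lambda>n. form_energy (\<E>n n) (\<F>n n) (u n))"
    and \<alpha>: "0 < \<alpha>" and f: "f \<in> l2_space m" and e: "0 < e"
  shows "\<forall>\<^sub>F n in sequentially. l2_inner m f (n.resolvent n \<alpha> f) < l2_inner m f (resolvent \<alpha> f) + e"
proof (rule ccontr)
  define R where "R n = n.resolvent n \<alpha> f" for n
  define c where "c = l2_inner m f (resolvent \<alpha> f)"
  have R: "R n \<in> \<F>n n" "R n \<in> l2_space m" for n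
    unfolding R_def using n.resolvent_domain[OF \<alpha> f] by auto
  assume "\<not> ?thesis"
  from not_eventually_sequentiallyD[OF this, folded R_def c_def, unfolded not_less]
  obtain s :: "nat \<Rightarrow> nat" where s: "strict_mono s" "\<And>k. c + e \<le> l2_inner m f (R (s k))"
    by blast
  have "l2_norm m (R (s k)) \<le> l2_norm m f / \<alpha>" for k
    using n.resolvent_norm_le[OF \<alpha> f, of "s k"] \<alpha> by (simp add: R_def field_simps)
  then obtain t w where t: "strict_mono t" and w: "w \<in> l2_space m"
    and weak: "\<And>g. g \<in> l2_space m \<Longrightarrow> (\<lambda>k. l2_inner m (R (s (t k))) g) \<longlonglongrightarrow> l2_inner m w g"
    using l2.weak_sequential_compactness[where m=m and u="\<lambda>k. R (s k)", OF R(2)] by metis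
  define q where "q = s \<circ> t"
  have q: "strict_mono q" unfolding q_def by (rule strict_mono_o[OF s(1) t])
  define u where "u n = (if n \<in> range q then R n else w)" for n
  have u: "u n \<in> l2_space m" for n using R(2) w by (simp add: u_def)
  have "l2_weak_tendsto m u w"
    unfolding l2_weak_tendsto_def
  proof
    fix g assume "g \<in> l2_space m"
    then have "(\<lambda>k. l2_inner m (R (q k)) g) \<longlonglongrightarrow> l2_inner m w g" using weak by (simp add: q_def)
    from LIMSEQ_fill_subsequence[OF q this]
    show "(\<lambda>n. l2_inner m (u n) g) \<longlonglongrightarrow> l2_inner m w g" by (simp add: u_def if_distrib[of "\<lambda>f. l2_inner m f g"])
  qed
  then have "form_energy \<E> \<F> w \<le> liminf (\<lambda>n. form_energy (\<E>n n) (\<F>n n) (u n))"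
    by (intro mosco u w)
  also have "\<dots> \<le> liminf ((\<lambda>n. form_energy (\<E>n n) (\<F>n n) (u n)) \<circ> q)"
    by (rule liminf_subseq_mono[OF q])
  also have "(\<lambda>n. form_energy (\<E>n n) (\<F>n n) (u n)) \<circ> q = (\<lambda>k. ereal (\<E>n (q k) (R (q k)) (R (q k))))"
    using R(1) by (simp add: fun_eq_iff u_def form_energy_def)
  \<comment> \<open>The energy of R is (f, R) - \<alpha> |R|^2. Writing (f, R) as 2 (f, R) - (f, R)
    allows the lower bound \<open>c + e\<close> to enter, and |R|^2 is replaced by its tangent at w,
    so that everything left is affine in R and converges weakly.\<close>
  also have "liminf \<dots> \<le> liminf (\<lambda>k. ereal (2 * l2_inner m (R (q k)) f - \<alpha> * (2 * l2_inner m (R (q k)) w - (l2_norm m w)\<^sup>2) - (c + e)))"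
  proof (intro Liminf_mono always_eventually allI, simp only: ereal_less_eq)
    fix k
    have "0 \<le> (l2_norm m (R (q k) - w))\<^sup>2" by simp
    then have "2 * l2_inner m (R (q k)) w - (l2_norm m w)\<^sup>2 \<le> (l2_norm m (R (q k)))\<^sup>2"
      using R(2) w l2.ip_commute[OF w R(2), of "q k"]
      by (simp add: l2.nrm_square l2.ip_diff_left l2.ip_diff_right)
    then have "\<alpha> * (2 * l2_inner m (R (q k)) w - (l2_norm m w)\<^sup>2) \<le> \<alpha> * (l2_norm m (R (q k)))\<^sup>2"
      using \<alpha> by (intro mult_left_mono) auto
    moreover have "\<E>n (q k) (R (q k)) (R (q k)) + \<alpha> * (l2_norm m (R (q k)))\<^sup>2 = l2_inner m f (R (q k))"
      unfolding R_def by (rule n.resolvent_value[OF \<alpha> f])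
    moreover have "c + e \<le> l2_inner m f (R (q k))" using s(2) by (simp add: q_def)
    moreover have "l2_inner m (R (q k)) f = l2_inner m f (R (q k))" by (rule l2.ip_commute[OF R(2) f])
    ultimately show "\<E>n (q k) (R (q k)) (R (q k))
        \<le> 2 * l2_inner m (R (q k)) f - \<alpha> * (2 * l2_inner m (R (q k)) w - (l2_norm m w)\<^sup>2) - (c + e)"
      by argo
  qed
  also have "\<dots> = ereal (2 * l2_inner m w f - \<alpha> * (2 * l2_inner m w w - (l2_norm m w)\<^sup>2) - (c + e))"
  proof (rule lim_imp_Liminf)
    have lf: "(\<lambda>k. l2_inner m (R (q k)) f) \<longlonglongrightarrow> l2_inner m w f" and lw: "(\<lambda>k. l2_inner m (R (q k)) w) \<longlonglongrightarrow> l2_inner m w w"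
      using weak[OF f] weak[OF w] by (simp_all add: q_def)
    show "(\<lambda>k. ereal (2 * l2_inner m (R (q k)) f - \<alpha> * (2 * l2_inner m (R (q k)) w - (l2_norm m w)\<^sup>2) - (c + e)))
        \<longlonglongrightarrow> ereal (2 * l2_inner m w f - \<alpha> * (2 * l2_inner m w w - (l2_norm m w)\<^sup>2) - (c + e))"
      by (intro tendsto_ereal tendsto_intros lf lw)
  qed simp
  finally have le: "form_energy \<E> \<F> w \<le> ereal (2 * l2_inner m w f - \<alpha> * (2 * l2_inner m w w - (l2_norm m w)\<^sup>2) - (c + e))" .
  \<comment> \<open>The energy of w is bounded by a real number, and the energy is infinite off the
    domain.\<close>
  then have wF: "w \<in> \<F>" by (auto simp: form_energy_def split: if_splits)
  with le have "\<E> w w \<le> 2 * l2_inner m w f - \<alpha> * l2_inner m w w - (c + e)"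
    using w by (simp add: form_energy_def l2.nrm_square)
  moreover have "2 * l2_inner m f w - (\<E> w w + \<alpha> * l2_inner m w w) \<le> c"
    using resolvent_variational[OF \<alpha> f wF] by (simp add: c_def form_alpha_def)
  moreover have "l2_inner m w f = l2_inner m f w" by (rule l2.ip_commute[OF w f])
  ultimately show False using e by argo
qed

theorem mosco_imp_value_tendsto:
  assumes mosco: "mosco_converges m \<E>n \<F>n \<E> \<F>" and \<alpha>: "0 < \<alpha>" and f: "f \<in> l2_space m"
  shows "value_tendsto \<alpha> f"
  unfolding value_tendsto_def
proof (rule order_tendstoI)
  have R: "resolvent \<alpha> f \<in> l2_space m" using resolvent_domain[OF \<alpha> f] by (rule domain_l2')
  fix a
  show "\<forall>\<^sub>F n in sequentially. a < l2_inner m f (n.resolvent n \<alpha> f)" if "a < l2_inner m f (resolvent \<alpha> f)"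
    using value_lower[OF _ \<alpha> f, of "l2_inner m f (resolvent \<alpha> f) - a"] mosco R that
    unfolding mosco_converges_def by simp
  show "\<forall>\<^sub>F n in sequentially. l2_inner m f (n.resolvent n \<alpha> f) < a" if "l2_inner m f (resolvent \<alpha> f) < a"
    using value_upper[OF _ \<alpha> f, of "a - l2_inner m f (resolvent \<alpha> f)"] mosco that
    unfolding mosco_converges_def by simp
qed

section \<open>From convergence of the values back to Mosco convergence\<close>

lemma value_tendsto_imp_recovery:
  assumes val_lim: "\<And>\<alpha> f. 0 < \<alpha> \<Longrightarrow> f \<in> l2_closure m \<F> \<Longrightarrow> value_tendsto \<alpha> f" and v: "v \<in> \<F>" and e: "0 < e"
  shows "\<forall>\<^sub>F n in sequentially. \<exists>u\<in>\<F>n n. (l2_norm m (u - v))\<^sup>2 < e \<and> \<E>n n u u < \<E> v v + e"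
proof -
  \<comment> \<open>Chosen with \<open>\<beta> * e = \<E> v v + e\<close>, so that bounding energy
    plus \<beta> times squared distance by this one number gives both required estimates.\<close>
  define \<beta> where "\<beta> = (\<E> v v + e) / e"
  have Ev: "0 \<le> \<E> v v" by (rule form.ip_nonneg[OF v])
  have \<beta>: "0 < \<beta>" "\<beta> * e = \<E> v v + e" using Ev e by (simp_all add: \<beta>_def)
  \<comment> \<open>For this f the functional of the variational principle with shift \<beta> is, up
    to sign and the constant \<beta> |v|^2, the energy of u plus \<beta> |u - v|^2; the resolvent of
    f is the minimizer.\<close>
  define f where "f = \<beta> *\<^sub>R v"
  have vl2: "v \<in> l2_space m" using v by (rule domain_l2')
  have "f \<in> \<F>" using v by (simp add: f_def)
  then have f: "f \<in> l2_closure m \<F>" "f \<in> l2_space m" using subset_l2_closure[OF domain_l2] by auto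
  have inner_f: "l2_inner m f u = \<beta> * l2_inner m u v" if "u \<in> l2_space m" for u
    using that vl2 l2.ip_commute[OF vl2 that] by (simp add: f_def l2.ip_scale_left)
  have "2 * l2_inner m f v - form_alpha m \<E> \<beta> v v \<le> l2_inner m f (resolvent \<beta> f)"
    by (rule resolvent_variational[OF \<beta>(1) f(2) v])
  then have "\<beta> * l2_inner m v v - \<E> v v - e < l2_inner m f (resolvent \<beta> f)"
    using inner_f[OF vl2] e by (simp add: form_alpha_def)
  then have "\<forall>\<^sub>F n in sequentially. \<beta> * l2_inner m v v - \<E> v v - e < l2_inner m f (n.resolvent n \<beta> f)"
    using val_lim[OF \<beta>(1) f(1)] unfolding value_tendsto_def by (rule order_tendstoD(1)[rotated])
  then show ?thesis
  proof eventually_elim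
    case (elim n)
    define u where "u = n.resolvent n \<beta> f"
    have u: "u \<in> \<F>n n" unfolding u_def by (rule n.resolvent_domain[OF \<beta>(1) f(2)])
    have ul2: "u \<in> l2_space m" using u by (rule n.domain_l2')
    have "\<E>n n u u + \<beta> * (l2_norm m u)\<^sup>2 = l2_inner m f u"
      unfolding u_def by (rule n.resolvent_value[OF \<beta>(1) f(2)])
    moreover have "\<beta> * (l2_norm m (u - v))\<^sup>2 = \<beta> * (l2_norm m u)\<^sup>2 - 2 * l2_inner m f u + \<beta> * l2_inner m v v"
      using ul2 vl2 l2.ip_commute[OF vl2 ul2] inner_f[OF ul2]
      by (simp add: l2.nrm_square l2.ip_diff_left l2.ip_diff_right algebra_simps)
    ultimately have sum: "\<E>n n u u + \<beta> * (l2_norm m (u - v))\<^sup>2 < \<E> v v + e"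
      using elim by (simp add: u_def)
    have nonneg: "0 \<le> \<E>n n u u" "0 \<le> \<beta> * (l2_norm m (u - v))\<^sup>2"
      using n.form.ip_nonneg[OF u] \<beta>(1) by simp_all
    have "\<beta> * (l2_norm m (u - v))\<^sup>2 < \<beta> * e" using sum nonneg(1) \<beta>(2) by simp
    then have "(l2_norm m (u - v))\<^sup>2 < e" using \<beta>(1) by simp
    moreover have "\<E>n n u u < \<E> v v + e" using sum nonneg(2) by simp
    ultimately show ?case using u by blast
  qed
qed

text \<open>\<open>D n u\<close> measures how far u is from serving as an e-recovery vector, and its
  infimum \<open>d n\<close> tends to 0. Choosing u within \<open>1 / real (Suc n)\<close> of the
  infimum replaces a diagonal choice over e. Off \<open>\<F>\<close> the bound is infinite and a
  constant sequence works.\<close>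

lemma value_tendsto_imp_mosco_limsup:
  assumes val_lim: "\<And>\<alpha> f. 0 < \<alpha> \<Longrightarrow> f \<in> l2_closure m \<F> \<Longrightarrow> value_tendsto \<alpha> f" and v: "v \<in> l2_space m"
  shows "\<exists>u. (\<forall>n. u n \<in> l2_space m) \<and> l2_tendsto m u v \<and>
    limsup (\<lambda>n. form_energy (\<E>n n) (\<F>n n) (u n)) \<le> form_energy \<E> \<F> v"
proof (cases "v \<in> \<F>")
  case False
  have "l2_tendsto m (\<lambda>n. v) v" using l2.nrm_zero by (simp add: l2_tendsto_altdef)
  then show ?thesis using False v by (intro exI[of _ "\<lambda>n. v"]) (simp add: form_energy_def)
next
  case True
  define D where "D n u = max ((l2_norm m (u - v))\<^sup>2) (\<E>n n u u - \<E> v v)" for n u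
  define d where "d n = (INF u\<in>\<F>n n. D n u)" for n
  have D_nonneg: "0 \<le> D n u" for n u by (simp add: D_def le_max_iff_disj)
  then have bdd: "bdd_below (D n ` \<F>n n)" for n by (intro bdd_belowI[of _ 0]) auto
  have ne: "\<F>n n \<noteq> {}" for n using n.form.mem(1) by blast
  have d_nonneg: "0 \<le> d n" for n unfolding d_def by (rule cINF_greatest[OF ne D_nonneg])
  have "d \<longlonglongrightarrow> 0"
  proof (rule order_tendstoI)
    fix a :: real assume "0 < a"
    then have "\<forall>\<^sub>F n in sequentially. \<exists>u\<in>\<F>n n. (l2_norm m (u - v))\<^sup>2 < a \<and> \<E>n n u u < \<E> v v + a"
      by (intro value_tendsto_imp_recovery[OF val_lim True])
    then show "\<forall>\<^sub>F n in sequentially. d n < a"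
    proof eventually_elim
      case (elim n)
      then obtain u where u: "u \<in> \<F>n n" "(l2_norm m (u - v))\<^sup>2 < a" "\<E>n n u u < \<E> v v + a" by blast
      have "d n \<le> D n u" unfolding d_def by (rule cINF_lower[OF bdd u(1)])
      also have "\<dots> < a" using u by (simp add: D_def)
      finally show ?case .
    qed
  next
    show "\<forall>\<^sub>F n in sequentially. a < d n" if "a < 0" for a
      using less_le_trans[OF that d_nonneg] by (intro always_eventually allI)
  qed
  then have lim: "(\<lambda>n. d n + 1 / real (Suc n)) \<longlonglongrightarrow> 0"
    using tendsto_add[OF _ LIMSEQ_Suc[OF lim_1_over_n]] by fastforce
  have "\<exists>u\<in>\<F>n n. D n u < d n + 1 / real (Suc n)" for n
    using cINF_less_iff[OF ne bdd, of n "d n + 1 / real (Suc n)"] unfolding d_def[symmetric] by simp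
  then obtain u where u: "\<And>n. u n \<in> \<F>n n" and Du: "\<And>n. D n (u n) < d n + 1 / real (Suc n)" by metis
  have norm_le: "(l2_norm m (u n - v))\<^sup>2 \<le> d n + 1 / real (Suc n)" and E_le: "\<E>n n (u n) (u n) \<le> \<E> v v + (d n + 1 / real (Suc n))" for n
    using Du[of n] by (simp_all add: D_def)
  have "(\<lambda>n. (l2_norm m (u n - v))\<^sup>2) \<longlonglongrightarrow> 0"
    by (rule tendsto_sandwich[OF _ _ tendsto_const lim]) (use norm_le in \<open>auto intro: always_eventually\<close>)
  then have "l2_tendsto m u v"
    using tendsto_real_sqrt[of "\<lambda>n. (l2_norm m (u n - v))\<^sup>2" 0 sequentially] v n.domain_l2'[OF u]
    by (simp add: l2_tendsto_altdef)
  moreover have "limsup (\<lambda>n. form_energy (\<E>n n) (\<F>n n) (u n)) \<le> form_energy \<E> \<F> v"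
  proof -
    have "limsup (\<lambda>n. form_energy (\<E>n n) (\<F>n n) (u n)) \<le> limsup (\<lambda>n. ereal (\<E> v v + (d n + 1 / real (Suc n))))"
      using u E_le by (intro Limsup_mono always_eventually) (simp add: form_energy_def)
    also have "\<dots> = ereal (\<E> v v + 0)"
      by (intro lim_imp_Limsup tendsto_ereal tendsto_add tendsto_const lim) simp
    finally show ?thesis using True by (simp add: form_energy_def)
  qed
  ultimately show ?thesis using n.domain_l2'[OF u] by blast
qed

text \<open>The component g of v orthogonal to the limit closure has limit projection 0, so its
  projections along the sequence tend to 0 in norm. Since \<open>u k\<close> sees only the
  projection of g, its product with g tends to 0; hence g is orthogonal to v and so to
  itself.\<close>

lemma mem_closure_of_weak_limit:
  assumes proj: "\<And>f. f \<in> l2_space m \<Longrightarrow>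
      l2_tendsto m (\<lambda>n. l2_proj m (l2_closure m (\<F>n n)) f) (l2_proj m (l2_closure m \<F>) f)"
    and r: "strict_mono (r :: nat \<Rightarrow> nat)" and u: "\<And>k. u k \<in> \<F>n (r k)" and bdd: "\<And>k. l2_norm m (u k) \<le> M"
    and v: "v \<in> l2_space m" and weak: "\<And>g. g \<in> l2_space m \<Longrightarrow> (\<lambda>k. l2_inner m (u k) g) \<longlonglongrightarrow> l2_inner m v g"
  shows "v \<in> l2_closure m \<F>"
proof -
  note F = form.subspace domain_l2
  define p where "p = l2_proj m (l2_closure m \<F>)"
  define pn where "pn n = l2_proj m (l2_closure m (\<F>n n))" for n
  have p: "p f \<in> l2_closure m \<F>" "p f \<in> l2_space m" "w \<in> l2_closure m \<F> \<Longrightarrow> l2_inner m (f - p f) w = 0"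
    if "f \<in> l2_space m" for f w
    using l2_proj[OF F that] l2_closure_subset unfolding p_def by blast+
  have pn: "pn n f \<in> l2_space m" "w \<in> \<F>n n \<Longrightarrow> l2_inner m (f - pn n f) w = 0"
    if "f \<in> l2_space m" for n f w
    using l2_proj[OF n.form.subspace n.domain_l2 that] l2_closure_subset subset_l2_closure[OF n.domain_l2]
    unfolding pn_def by blast+
  define g where "g = v - p v"
  have g: "g \<in> l2_space m" using v p(2)[OF v] by (simp add: g_def)
  have orth: "l2_inner m g w = 0" if "w \<in> l2_closure m \<F>" for w
    using p(3)[OF v that] by (simp add: g_def)
  have "l2_inner m (p g) (p g) = 0"
    using p(3)[OF g p(1)[OF g]] orth[OF p(1)[OF g]] g p(2)[OF g] by (simp add: l2.ip_diff_left)
  then have "l2_norm m (p g) = 0" by (simp add: l2_norm_def)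
  moreover have "(\<lambda>n. l2_norm m (pn n g)) \<longlonglongrightarrow> l2_norm m (p g)"
    using proj[OF g] pn(1)[OF g] p(2)[OF g] unfolding p_def pn_def l2_tendsto_altdef
    by (intro l2.tendsto_nrm) auto
  ultimately have "(\<lambda>k. l2_norm m (pn (r k) g)) \<longlonglongrightarrow> 0"
    using LIMSEQ_subseq_LIMSEQ[OF _ r, of "\<lambda>n. l2_norm m (pn n g)"] by (simp add: o_def)
  then have "(\<lambda>k. l2_inner m (u k) g) \<longlonglongrightarrow> 0"
  proof (rule tendsto_0_le[of _ _ _ M], intro always_eventually allI)
    fix k
    have uk: "u k \<in> l2_space m" using u by (rule n.domain_l2')
    have "l2_inner m (u k) g = l2_inner m (u k) (pn (r k) g)"
      using pn(2)[OF g u[of k]] pn(1)[OF g] uk g l2.ip_commute[OF uk]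
      by (simp add: l2.ip_diff_left)
    also have "\<bar>\<dots>\<bar> \<le> l2_norm m (u k) * l2_norm m (pn (r k) g)"
      by (rule l2.Cauchy_Schwarz[OF uk pn(1)[OF g]])
    also have "\<dots> \<le> M * l2_norm m (pn (r k) g)"
      by (rule mult_right_mono[OF bdd l2.nrm_nonneg[OF pn(1)[OF g]]])
    finally show "norm (l2_inner m (u k) g) \<le> norm (l2_norm m (pn (r k) g)) * M"
      using l2.nrm_nonneg[OF pn(1)[OF g], of "r k"] by (simp add: mult.commute)
  qed
  then have "l2_inner m v g = 0" using LIMSEQ_unique[OF weak[OF g]] by blast
  moreover have "l2_inner m (p v) g = 0"
    using orth[OF p(1)[OF v]] l2.ip_commute[OF g p(2)[OF v]] by simp
  ultimately have "l2_inner m g g = 0"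
    using v p(2)[OF v] g by (metis g_def l2.ip_diff_left diff_self)
  then have "l2_norm m g = 0" by (simp add: l2_norm_def)
  \<comment> \<open>\<open>v\<close> and \<open>p v\<close> agree only up to a null function;
    membership follows from closedness applied to the constant sequence \<open>p v\<close>.\<close>
  then have "l2_norm m (p v - v) = 0"
    using l2.nrm_minus_commute[OF v p(2)[OF v]] by (simp add: g_def)
  then show ?thesis
    by (intro l2_closure_closed[OF domain_l2 p(1)[OF v] v]) simp
qed

text \<open>The dual description \<open>\<E>\<^sub>\<beta>(v, v) = sup (2 (f, v) - (G\<^sub>\<beta> f, f))\<close> is used with \<open>f = \<gamma> (v - h)\<close>,
  \<open>h = \<gamma> G\<^bsub>\<beta>+\<gamma>\<^esub> v\<close>, for which \<open>h = G\<^sub>\<beta> f\<close>.\<close>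

lemma energy_le_of_dual_bound:
  assumes v: "v \<in> l2_closure m \<F>" and \<beta>: "0 < \<beta>"
    and dual: "\<And>f. f \<in> l2_closure m \<F> \<Longrightarrow> 2 * l2_inner m f v - l2_inner m f (resolvent \<beta> f) \<le> L"
  shows "v \<in> \<F>" and "\<E> v v \<le> L"
proof -
  have vl2: "v \<in> l2_space m" using v l2_closure_subset by blast
  define h where "h k = resolvent (\<beta> + real (Suc k)) (real (Suc k) *\<^sub>R v)" for k
  have h: "h k \<in> \<F>" for k
    unfolding h_def using \<beta> vl2 by (intro resolvent_domain) auto
  \<comment> \<open>The first term keeps the energies bounded; the second, with its growing factor,
    forces \<open>h k\<close> to converge to \<open>v\<close>. Lower semicontinuity then
    finishes.\<close>
  have bound: "\<E> (h k) (h k) + 2 * real (Suc k) * (l2_norm m (h k - v))\<^sup>2 \<le> L" for k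
  proof -
    define \<gamma> where "\<gamma> = real (Suc k)"
    have \<gamma>: "0 < \<gamma>" by (simp add: \<gamma>_def)
    define f where "f = \<gamma> *\<^sub>R (v - h k)"
    have hk: "h k \<in> \<F>" "h k \<in> l2_space m" using h by auto
    have "v - h k \<in> l2_closure m \<F>"
      using subspace_diff[OF subspace_l2_closure[OF form.subspace domain_l2] v] hk(1) subset_l2_closure[OF domain_l2]
      by blast
    then have f: "f \<in> l2_closure m \<F>"
      unfolding f_def by (rule subspace_scale[OF subspace_l2_closure[OF form.subspace domain_l2]])
    have fl2: "f \<in> l2_space m" using f l2_closure_subset by blast
    have eq: "form_alpha m \<E> \<beta> (h k) g = l2_inner m f g" if g: "g \<in> \<F>" for g
    proof -
      have "form_alpha m \<E> (\<beta> + \<gamma>) (h k) g = l2_inner m (\<gamma> *\<^sub>R v) g"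
        unfolding h_def \<gamma>_def[symmetric] using \<beta> \<gamma> vl2 g by (intro resolvent_eq) auto
      then show ?thesis
        using vl2 hk(2) g by (simp add: form_alpha_def f_def l2.ip_scale_left l2.ip_diff_left algebra_simps)
    qed
    interpret A: semi_inner_space \<F> "form_alpha m \<E> \<beta>" by (rule alpha_inner[OF \<beta>])
    have R: "resolvent \<beta> f \<in> \<F>" by (rule resolvent_domain[OF \<beta> fl2])
    \<comment> \<open>\<open>resolvent \<beta> f\<close> and \<open>h k\<close> solve the same
      equation but may differ on a null set, so only their products with f are compared.\<close>
    have "l2_inner m f (resolvent \<beta> f) = form_alpha m \<E> \<beta> (h k) (resolvent \<beta> f)" by (simp add: eq R)
    also have "\<dots> = l2_inner m f (h k)"
      using resolvent_eq[OF \<beta> fl2 hk(1)] A.ip_commute[OF hk(1) R] by simp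
    finally have "2 * l2_inner m f v - l2_inner m f (h k) \<le> L" using dual[OF f] by simp
    moreover have "l2_inner m f v = l2_inner m f (h k) + \<gamma> * (l2_norm m (h k - v))\<^sup>2"
      using vl2 hk(2) l2.ip_commute[OF hk(2) vl2]
      by (simp add: f_def l2.nrm_square l2.ip_scale_left l2.ip_diff_left l2.ip_diff_right algebra_simps)
    moreover have "\<E> (h k) (h k) \<le> l2_inner m f (h k)"
      using eq[OF hk(1)] mult_nonneg_nonneg[OF less_imp_le[OF \<beta>] l2.ip_nonneg[OF hk(2)]]
      by (simp add: form_alpha_def)
    ultimately have "\<E> (h k) (h k) + 2 * (\<gamma> * (l2_norm m (h k - v))\<^sup>2) \<le> L" by argo
    then show ?thesis by (simp only: \<gamma>_def mult.assoc)
  qed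
  have E_le: "\<E> (h k) (h k) \<le> L" for k
  proof -
    have "0 \<le> 2 * real (Suc k) * (l2_norm m (h k - v))\<^sup>2" by simp
    then show ?thesis using bound[of k] by argo
  qed
  have norm_le: "(l2_norm m (h k - v))\<^sup>2 \<le> L * (1 / real (Suc k))" for k
  proof -
    have "real (Suc k) * (l2_norm m (h k - v))\<^sup>2 \<le> L"
      using bound[of k, unfolded mult.assoc] form.ip_nonneg[OF h[of k]]
        mult_nonneg_nonneg[OF of_nat_0_le_iff zero_le_power2, of "Suc k" "l2_norm m (h k - v)"]
      by argo
    then show ?thesis by (simp add: field_simps)
  qed
  have lim0: "(\<lambda>k. L * (1 / real (Suc k))) \<longlonglongrightarrow> 0"
    using tendsto_mult_right_zero[OF LIMSEQ_Suc[OF lim_1_over_n]] by blast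
  have "(\<lambda>k. (l2_norm m (h k - v))\<^sup>2) \<longlonglongrightarrow> 0"
    by (rule tendsto_sandwich[OF always_eventually always_eventually tendsto_const lim0])
      (intro allI zero_le_power2, intro allI norm_le)
  then have lim: "(\<lambda>k. l2_norm m (h k - v)) \<longlonglongrightarrow> 0"
    using tendsto_real_sqrt[of "\<lambda>k. (l2_norm m (h k - v))\<^sup>2" 0 sequentially] vl2 domain_l2'[OF h] by simp
  show "v \<in> \<F>" by (rule lower_semicontinuous(1)[OF h vl2 lim E_le])
  show "\<E> v v \<le> L" by (rule lower_semicontinuous(2)[OF h vl2 lim E_le])
qed

text \<open>Along a subsequence with energies below L, each \<open>u (r k)\<close> is a competitor,
  which bounds 2 (u, f) - (f, G f) by L + \<beta> M^2; this is affine in u and survives the weak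
  limit. The bound M comes from uniform boundedness, and letting \<beta> tend to 0 removes its
  contribution.\<close>

lemma value_tendsto_imp_mosco_liminf:
  assumes val_lim: "\<And>\<alpha> f. 0 < \<alpha> \<Longrightarrow> f \<in> l2_closure m \<F> \<Longrightarrow> value_tendsto \<alpha> f"
    and proj: "\<And>f. f \<in> l2_space m \<Longrightarrow>
      l2_tendsto m (\<lambda>n. l2_proj m (l2_closure m (\<F>n n)) f) (l2_proj m (l2_closure m \<F>) f)"
    and u: "\<And>n. u n \<in> l2_space m" and v: "v \<in> l2_space m" and weak: "l2_weak_tendsto m u v"
  shows "form_energy \<E> \<F> v \<le> liminf (\<lambda>n. form_energy (\<E>n n) (\<F>n n) (u n))"
proof (rule ccontr)
  assume "\<not> ?thesis"
  then obtain L :: real where L: "liminf (\<lambda>n. form_energy (\<E>n n) (\<F>n n) (u n)) < ereal L" "ereal L < form_energy \<E> \<F> v"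
    using ereal_dense2 unfolding not_le by blast
  have "\<not> (\<forall>\<^sub>F n in sequentially. ereal L \<le> form_energy (\<E>n n) (\<F>n n) (u n))"
  proof
    assume "\<forall>\<^sub>F n in sequentially. ereal L \<le> form_energy (\<E>n n) (\<F>n n) (u n)"
    from Liminf_bounded[OF this] show False using L(1) by simp
  qed
  from not_eventually_sequentiallyD[OF this, unfolded not_le]
  obtain r :: "nat \<Rightarrow> nat" where r: "strict_mono r"
    and "\<forall>k. form_energy (\<E>n (r k)) (\<F>n (r k)) (u (r k)) < ereal L"
    by blast
  then have ur: "u (r k) \<in> \<F>n (r k)" "\<E>n (r k) (u (r k)) (u (r k)) < L" for k
    by (simp_all add: form_energy_less_iff)
  have weak': "(\<lambda>n. l2_inner m (u n) g) \<longlonglongrightarrow> l2_inner m v g" if "g \<in> l2_space m" for g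
    using weak that by (simp add: l2_weak_tendsto_def)
  have "Bseq (\<lambda>n. l2_inner m (u n) g)" if "g \<in> l2_space m" for g
    by (rule convergent_imp_Bseq[OF convergentI[OF weak'[OF that]]])
  then obtain M where M: "\<And>n. l2_norm m (u n) \<le> M"
    using l2.uniform_boundedness[where m=m and u=u, OF u] by metis
  have weak_r: "(\<lambda>k. l2_inner m (u (r k)) g) \<longlonglongrightarrow> l2_inner m v g" if "g \<in> l2_space m" for g
    using LIMSEQ_subseq_LIMSEQ[OF weak'[OF that] r] by (simp add: o_def)
  have vH: "v \<in> l2_closure m \<F>"
    by (rule mem_closure_of_weak_limit[OF proj r ur(1) M v weak_r])
  have dual: "2 * l2_inner m f v - l2_inner m f (resolvent \<beta> f) \<le> L + \<beta> * M\<^sup>2"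
    if \<beta>: "0 < \<beta>" and f: "f \<in> l2_closure m \<F>" for f \<beta>
  proof -
    have fl2: "f \<in> l2_space m" using f l2_closure_subset by blast
    have val: "(\<lambda>k. l2_inner m f (n.resolvent (r k) \<beta> f)) \<longlonglongrightarrow> l2_inner m f (resolvent \<beta> f)"
      using LIMSEQ_subseq_LIMSEQ[OF val_lim[OF \<beta> f, unfolded value_tendsto_def] r] by (simp add: o_def)
    have "2 * l2_inner m (u (r k)) f - l2_inner m f (n.resolvent (r k) \<beta> f) \<le> L + \<beta> * M\<^sup>2" for k
    proof -
      have "2 * l2_inner m f (u (r k)) - (\<E>n (r k) (u (r k)) (u (r k)) + \<beta> * (l2_norm m (u (r k)))\<^sup>2)
          \<le> l2_inner m f (n.resolvent (r k) \<beta> f)"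
        using n.resolvent_variational[OF \<beta> fl2 ur(1)[of k]] u by (simp add: form_alpha_def l2.nrm_square)
      moreover have "\<beta> * (l2_norm m (u (r k)))\<^sup>2 \<le> \<beta> * M\<^sup>2"
        using \<beta> M[of "r k"] l2.nrm_nonneg[OF u, of "r k"] by (intro mult_left_mono power_mono) auto
      moreover have "l2_inner m (u (r k)) f = l2_inner m f (u (r k))" by (rule l2.ip_commute[OF u fl2])
      ultimately show ?thesis using ur(2)[of k] by argo
    qed
    then have "2 * l2_inner m v f - l2_inner m f (resolvent \<beta> f) \<le> L + \<beta> * M\<^sup>2"
      by (intro LIMSEQ_le_const2[OF tendsto_diff[OF tendsto_mult_left[OF weak_r[OF fl2]] val]]) blast
    then show ?thesis using l2.ip_commute[OF v fl2] by simp
  qed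
  have vF: "v \<in> \<F>" by (rule energy_le_of_dual_bound(1)[OF vH zero_less_one dual[OF zero_less_one]])
  have "\<E> v v \<le> L + e" if e: "0 < e" for e
  proof -
    define \<beta> where "\<beta> = e / (M\<^sup>2 + 1)"
    have \<beta>: "0 < \<beta>" using e by (simp add: \<beta>_def add_nonneg_pos)
    have "\<beta> * M\<^sup>2 \<le> \<beta> * (M\<^sup>2 + 1)" using \<beta> by simp
    also have "\<dots> = e" unfolding \<beta>_def by (simp add: add_nonneg_eq_0_iff)
    finally show ?thesis using energy_le_of_dual_bound(2)[OF vH \<beta> dual[OF \<beta>]] by simp
  qed
  then have "\<E> v v \<le> L" by (rule field_le_epsilon)
  then show False using L(2) vF by (simp add: form_energy_def)
qed

theorem value_tendsto_imp_mosco: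
  assumes val_lim: "\<And>\<alpha> f. 0 < \<alpha> \<Longrightarrow> f \<in> l2_closure m \<F> \<Longrightarrow> value_tendsto \<alpha> f"
    and proj: "\<And>f. f \<in> l2_space m \<Longrightarrow>
      l2_tendsto m (\<lambda>n. l2_proj m (l2_closure m (\<F>n n)) f) (l2_proj m (l2_closure m \<F>) f)"
  shows "mosco_converges m \<E>n \<F>n \<E> \<F>"
  unfolding mosco_converges_def
proof (intro conjI allI impI ballI)
  fix u v assume "(\<forall>n. u n \<in> l2_space m) \<and> v \<in> l2_space m \<and> l2_weak_tendsto m u v"
  then show "form_energy \<E> \<F> v \<le> liminf (\<lambda>n. form_energy (\<E>n n) (\<F>n n) (u n))"
    by (intro value_tendsto_imp_mosco_liminf[OF val_lim proj]) auto
qed (rule value_tendsto_imp_mosco_limsup[OF val_lim])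

end

section \<open>Convergence of semigroups\<close>

locale semigroup_sequence = form_sequence m \<E> \<F> \<E>n \<F>n + form_semigroup m \<E> \<F> P
  for m :: "'a measure" and \<E> \<F> \<E>n \<F>n P +
  fixes Pn :: "nat \<Rightarrow> real \<Rightarrow> ('a \<Rightarrow> real) \<Rightarrow> 'a \<Rightarrow> real"
  assumes form_semigroup_n: "\<And>n. form_semigroup m (\<E>n n) (\<F>n n) (Pn n)"
    and closure_subset: "\<And>n. l2_closure m \<F> \<subseteq> l2_closure m (\<F>n n)"
begin

sublocale sg: form_semigroup m "\<E>n n" "\<F>n n" "Pn n" for n
  by (rule form_semigroup_n)

lemma mem_closure_n [simp, intro]: "f \<in> l2_closure m \<F> \<Longrightarrow> f \<in> l2_closure m (\<F>n n)"
  using closure_subset by blast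

lemma value_tendsto_iff_laplace:
  assumes \<alpha>: "0 < \<alpha>" and f: "f \<in> l2_closure m \<F>"
  shows "value_tendsto \<alpha> f \<longleftrightarrow> (\<lambda>n. integral {0..} (\<lambda>t. exp (- \<alpha> * t) * sg.diag n f t))
    \<longlonglongrightarrow> integral {0..} (\<lambda>t. exp (- \<alpha> * t) * diag f t)"
proof -
  have fl2: "f \<in> l2_space m" using f by blast
  have "l2_inner m (resolvent \<alpha> f) f = l2_inner m f (resolvent \<alpha> f)"
    by (rule l2.ip_commute[OF domain_l2'[OF resolvent_domain[OF \<alpha> fl2]] fl2])
  moreover have "l2_inner m (n.resolvent n \<alpha> f) f = l2_inner m f (n.resolvent n \<alpha> f)" for n
    by (rule l2.ip_commute[OF n.domain_l2'[OF n.resolvent_domain[OF \<alpha> fl2]] fl2])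
  ultimately show ?thesis
    unfolding value_tendsto_def laplace_diag[OF \<alpha> f] sg.laplace_diag[OF \<alpha> mem_closure_n[OF f]] by simp
qed

theorem semigroup_tendsto:
  assumes val_lim: "\<And>\<alpha> f. 0 < \<alpha> \<Longrightarrow> f \<in> l2_closure m \<F> \<Longrightarrow> value_tendsto \<alpha> f"
    and t: "0 < t" and f: "f \<in> l2_closure m \<F>"
  shows "l2_tendsto m (\<lambda>n. Pn n t f) (P t f)"
proof -
  have diag_lim: "(\<lambda>n. sg.diag n g s) \<longlonglongrightarrow> diag g s" if g: "g \<in> l2_closure m \<F>" and s: "0 < s" for g s
  proof (rule pointwise_tendsto_of_laplace[where \<phi>="diag g" and \<phi>n="\<lambda>n. sg.diag n g" and M="(l2_norm m g)\<^sup>2"])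
    show "continuous_on {0..} (diag g)" by (rule continuous_on_diag[OF g])
    show "continuous_on {0..} (sg.diag n g)" for n by (rule sg.continuous_on_diag[OF mem_closure_n[OF g]])
    show "\<bar>diag g x\<bar> \<le> (l2_norm m g)\<^sup>2" if "0 \<le> x" for x by (rule diag_bounded[OF that g])
    show "\<bar>sg.diag n g x\<bar> \<le> (l2_norm m g)\<^sup>2" if "0 \<le> x" for n x by (rule sg.diag_bounded[OF that mem_closure_n[OF g]])
    show "diag g y \<le> diag g x" if "0 \<le> x" "x \<le> y" for x y by (rule diag_antimono[OF that g])
    show "sg.diag n g y \<le> sg.diag n g x" if "0 \<le> x" "x \<le> y" for n x y by (rule sg.diag_antimono[OF that mem_closure_n[OF g]])
    show "(\<lambda>n. integral {0..} (\<lambda>t. exp (- a * t) * sg.diag n g t))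
        \<longlonglongrightarrow> integral {0..} (\<lambda>t. exp (- a * t) * diag g t)" if "0 < a" for a
      using val_lim[OF that g] value_tendsto_iff_laplace[OF that g] by simp
  qed (rule s)
  \<comment> \<open>Test vectors in the limit closure suffice, because the only one used below is
    \<open>P t f\<close>.\<close>
  have inner_lim: "(\<lambda>n. l2_inner m (Pn n t f) g) \<longlonglongrightarrow> l2_inner m (P t f) g" if g: "g \<in> l2_closure m \<F>" for g
  proof -
    have fg: "f + g \<in> l2_closure m \<F>" "f - g \<in> l2_closure m \<F>"
      using f g subspace_H by (simp_all add: subspace_add subspace_diff)
    have "(\<lambda>n. (sg.diag n (f + g) t - sg.diag n (f - g) t) / 4) \<longlonglongrightarrow> (diag (f + g) t - diag (f - g) t) / 4"
      by (intro tendsto_intros diag_lim fg t) simp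
    then show ?thesis
      unfolding inner_P_polarization[OF less_imp_le[OF t] f g]
        sg.inner_P_polarization[OF less_imp_le[OF t] mem_closure_n[OF f] mem_closure_n[OF g]] .
  qed
  have Pt: "P t f \<in> l2_closure m \<F>" "P t f \<in> l2_space m" using f t by auto
  have Pnt: "Pn n t f \<in> l2_space m" for n
    by (rule sg.H_l2'[OF sg.P_mem[OF less_imp_le[OF t] mem_closure_n[OF f]]])
  have norm_eq: "(l2_norm m (Pn n t f - P t f))\<^sup>2 = sg.diag n f (2 * t) - 2 * l2_inner m (Pn n t f) (P t f) + (l2_norm m (P t f))\<^sup>2" for n
    using sg.diag_eq_norm[of "2 * t" f n] f t Pt(2) Pnt[of n] l2.ip_commute[OF Pt(2) Pnt[of n]]
    by (simp add: l2.nrm_square l2.ip_diff_left l2.ip_diff_right)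
  have "diag f (2 * t) = (l2_norm m (P t f))\<^sup>2"
    using diag_eq_norm[of "2 * t" f] f t by simp
  then have "(\<lambda>n. sg.diag n f (2 * t) - 2 * l2_inner m (Pn n t f) (P t f) + (l2_norm m (P t f))\<^sup>2)
      \<longlonglongrightarrow> (l2_norm m (P t f))\<^sup>2 - 2 * (l2_norm m (P t f))\<^sup>2 + (l2_norm m (P t f))\<^sup>2"
    using diag_lim[OF f, of "2 * t"] inner_lim[OF Pt(1)] t Pt(2)
    by (intro tendsto_intros) (simp_all add: l2.nrm_square)
  then have "(\<lambda>n. (l2_norm m (Pn n t f - P t f))\<^sup>2) \<longlonglongrightarrow> 0"
    by (simp add: norm_eq)
  then have "(\<lambda>n. sqrt ((l2_norm m (Pn n t f - P t f))\<^sup>2)) \<longlonglongrightarrow> sqrt 0"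
    by (rule tendsto_real_sqrt)
  then show ?thesis
    using Pnt Pt(2) by (simp add: l2_tendsto_altdef)
qed

theorem semigroup_tendsto_imp_value_tendsto:
  assumes lim: "\<And>t f. 0 < t \<Longrightarrow> f \<in> l2_closure m \<F> \<Longrightarrow> l2_tendsto m (\<lambda>n. Pn n t f) (P t f)"
    and \<alpha>: "0 < \<alpha>" and f: "f \<in> l2_closure m \<F>"
  shows "value_tendsto \<alpha> f"
  unfolding value_tendsto_iff_laplace[OF \<alpha> f]
proof (rule laplace_tendsto_of_pointwise[OF _ _ _ \<alpha>])
  show "continuous_on {0..} (sg.diag n f)" for n by (rule sg.continuous_on_diag[OF mem_closure_n[OF f]])
  show "\<bar>sg.diag n f t\<bar> \<le> (l2_norm m f)\<^sup>2" if "0 \<le> t" for n t by (rule sg.diag_bounded[OF that mem_closure_n[OF f]])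
  show "(\<lambda>n. sg.diag n f t) \<longlonglongrightarrow> diag f t" if "0 \<le> t" for t
  \<comment> \<open>The assumed convergence covers only t > 0; at 0 all diagonal functions have the
    same value.\<close>
  proof (cases "t = 0")
    case True
    then show ?thesis using f by (simp add: diag_zero sg.diag_zero)
  next
    case False
    then show ?thesis
      unfolding diag_def sg.diag_def using lim[of t f] f that
      by (intro l2.tendsto_ip_left) (auto simp: l2_tendsto_altdef)
  qed
qed

end

section \<open>Tail invariance, and the passage to sequences indexed from 1\<close>

lemma mosco_converges_cong:
  assumes eq: "\<forall>\<^sub>F n in sequentially. \<E>n n = \<E>n' n \<and> \<F>n n = \<F>n' n"
  shows "mosco_converges m \<E>n \<F>n \<E> \<F> \<longleftrightarrow> mosco_converges m \<E>n' \<F>n' \<E> \<F>"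
proof -
  have ev: "\<forall>\<^sub>F n in sequentially. form_energy (\<E>n n) (\<F>n n) (u n) = form_energy (\<E>n' n) (\<F>n' n) (u n)" for u
    using eq by eventually_elim simp
  show ?thesis
    unfolding mosco_converges_def Liminf_eq[OF ev] Limsup_eq[OF ev] ..
qed

lemma l2_tendsto_cong: "\<forall>\<^sub>F n in sequentially. u n = u' n \<Longrightarrow> l2_tendsto m u v \<longleftrightarrow> l2_tendsto m u' v"
  unfolding l2_tendsto_def by (rule tendsto_cong) (auto elim: eventually_mono)

theorem theorem2p3:
  fixes m :: "'a::metric_space measure"
    and \<E> :: "('a \<Rightarrow> real) \<Rightarrow> ('a \<Rightarrow> real) \<Rightarrow> real"
    and \<F> :: "('a \<Rightarrow> real) set"
    and \<E>n :: "nat \<Rightarrow> ('a \<Rightarrow> real) \<Rightarrow> ('a \<Rightarrow> real) \<Rightarrow> real"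
    and \<F>n :: "nat \<Rightarrow> ('a \<Rightarrow> real) set"
    and P :: "real \<Rightarrow> ('a \<Rightarrow> real) \<Rightarrow> ('a \<Rightarrow> real)"
    and Pn :: "nat \<Rightarrow> real \<Rightarrow> ('a \<Rightarrow> real) \<Rightarrow> ('a \<Rightarrow> real)"
  assumes "locally_compact_space (euclidean :: 'a topology)"
    and "separable_space (euclidean :: 'a topology)"
    and "radon_measure m" and "full_support m"
    and "closed_symmetric_form m \<E> \<F>"
    and "\<And>n. n \<ge> 1 \<Longrightarrow> closed_symmetric_form m (\<E>n n) (\<F>n n)"
    and "\<And>n. n \<ge> 1 \<Longrightarrow> l2_closure m \<F> \<subseteq> l2_closure m (\<F>n n)"
    and "associated_semigroup m \<E> \<F> P"
    and "\<And>n. n \<ge> 1 \<Longrightarrow> associated_semigroup m (\<E>n n) (\<F>n n) (Pn n)"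
  shows "(mosco_converges m \<E>n \<F>n \<E> \<F> \<longrightarrow>
            (\<forall>t>0. \<forall>f\<in>l2_closure m \<F>. l2_tendsto m (\<lambda>n. Pn n t f) (P t f))) \<and>
         ((\<forall>f\<in>l2_space m.
             l2_tendsto m (\<lambda>n. l2_proj m (l2_closure m (\<F>n n)) f) (l2_proj m (l2_closure m \<F>) f)) \<longrightarrow>
          (\<forall>t>0. \<forall>f\<in>l2_closure m \<F>. l2_tendsto m (\<lambda>n. Pn n t f) (P t f)) \<longrightarrow>
            mosco_converges m \<E>n \<F>n \<E> \<F>)"
proof -
  \<comment> \<open>The hypotheses say nothing about the index 0, where the sequences are replaced by the limit.\<close>
  define \<E>' where "\<E>' n = (if n = 0 then \<E> else \<E>n n)" for n
  define \<F>' where "\<F>' n = (if n = 0 then \<F> else \<F>n n)" for n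
  define P' where "P' n = (if n = 0 then P else Pn n)" for n
  have ev: "\<forall>\<^sub>F n in sequentially. \<E>n n = \<E>' n \<and> \<F>n n = \<F>' n" "\<forall>\<^sub>F n in sequentially. \<F>n n = \<F>' n"
    "\<forall>\<^sub>F n in sequentially. Pn n = P' n"
    by (auto simp: eventually_sequentially \<E>'_def \<F>'_def P'_def intro!: exI[of _ 1])
  have form: "closed_form m \<E> \<F>" "closed_form m (\<E>' n) (\<F>' n)" for n
    using assms(5,6) by (simp_all add: closed_form_def \<E>'_def \<F>'_def)
  interpret semigroup_sequence m \<E> \<F> \<E>' \<F>' P P'
  proof -
    have "form_semigroup m \<E> \<F> P" "form_semigroup m (\<E>' n) (\<F>' n) (P' n)" for n
      using form assms(8,9)
      by (simp_all add: form_semigroup_def form_semigroup_axioms_def \<E>'_def \<F>'_def P'_def)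
    moreover have "l2_closure m \<F> \<subseteq> l2_closure m (\<F>' n)" for n
      using assms(7) by (simp add: \<F>'_def)
    ultimately show "semigroup_sequence m \<E> \<F> \<E>' \<F>' P P'"
      using form by (simp add: semigroup_sequence_def semigroup_sequence_axioms_def form_sequence_def form_sequence_axioms_def)
  qed
  have mosco: "mosco_converges m \<E>n \<F>n \<E> \<F> \<longleftrightarrow> mosco_converges m \<E>' \<F>' \<E> \<F>"
    by (rule mosco_converges_cong[OF ev(1)])
  have semi: "l2_tendsto m (\<lambda>n. Pn n t f) (P t f) \<longleftrightarrow> l2_tendsto m (\<lambda>n. P' n t f) (P t f)" for t f
    by (rule l2_tendsto_cong) (use ev(3) in eventually_elim, simp)
  have proj: "l2_tendsto m (\<lambda>n. l2_proj m (l2_closure m (\<F>n n)) f) g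
      \<longleftrightarrow> l2_tendsto m (\<lambda>n. l2_proj m (l2_closure m (\<F>' n)) f) g" for f g
    by (rule l2_tendsto_cong) (use ev(2) in eventually_elim, simp)
  show ?thesis
    unfolding mosco semi proj
  proof (intro conjI impI allI ballI)
    fix t :: real and f assume "mosco_converges m \<E>' \<F>' \<E> \<F>" "0 < t" "f \<in> l2_closure m \<F>"
    then show "l2_tendsto m (\<lambda>n. P' n t f) (P t f)"
      by (intro semigroup_tendsto mosco_imp_value_tendsto) auto
  next
    assume "\<forall>f\<in>l2_space m. l2_tendsto m (\<lambda>n. l2_proj m (l2_closure m (\<F>' n)) f) (l2_proj m (l2_closure m \<F>) f)"
      and "\<forall>t>0. \<forall>f\<in>l2_closure m \<F>. l2_tendsto m (\<lambda>n. P' n t f) (P t f)"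
    then show "mosco_converges m \<E>' \<F>' \<E> \<F>"
      by (intro value_tendsto_imp_mosco semigroup_tendsto_imp_value_tendsto) auto
  qed
qed

end
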